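(* Let $X$ be an infinite-dimensional Banach space. Then, for some $\varepsilon>0$, the closed unit ball $B_X$ of $X$ contains a symmetrically $(1+\varepsilon)$-separated sequence; that is, there exist $\varepsilon>0$ and a sequence $(x_n)_{n=1}^\infty\subseteq B_X$ such that $\|x_n+x_k\|\geq 1+\varepsilon$ and $\|x_n-x_k\|\geq 1+\varepsilon$ for all distinct $n,k\in\mathbb{N}$.
   Context: $B_X$ denotes the closed unit ball of $X$. A sequence $(x_n)_{n=1}^\infty$ in a normed space is symmetrically $\delta$-separated if $\|x_n\pm x_k\|\geq\delta$ (for both choices of sign) for all distinct $n,k\in\mathbb{N}$. *)

theory Defs
  imports "HOL-Analysis.Analysis"
begin

definition symmetrically_separated :: "real \<Rightarrow> (nat \<Rightarrow> 'a::real_normed_vector) \<Rightarrow> bool" where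
  "symmetrically_separated \<delta> x \<longleftrightarrow>
     (\<forall>n k. n \<noteq> k \<longrightarrow> norm (x n + x k) \<ge> \<delta> \<and> norm (x n - x k) \<ge> \<delta>)"

end

theory Submission
  imports Defs "HOL-Library.Ramsey"
begin

text \<open>If the differences of successive blocks \<open>u\<^sub>k\<close> of a basic sequence in the unit ball are
  \<open>(1 + \<epsilon>)\<close>-separated, then so are, after Ramsey, either the sums \<open>u\<^sub>i + u\<^sub>j\<close> or, up to scaling, the
  vectors \<open>u\<^sub>0 + u\<^sub>j\<close>, whose pairwise sums are large because of the common leading term \<open>2 u\<^sub>0\<close>.
  Hence it suffices to control differences of blocks.

  Fix a normalized basic sequence \<open>x\<close> whose tail projection constants tend to 1, and consider the
  alternating sums \<open>alt A = x\<^sub>a - x\<^sub>b + x\<^sub>c - \<dots>\<close> over finite sets \<open>A = {a < b < c < \<dots>}\<close>, so that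
  \<open>alt ({n} \<union> A) = x\<^sub>n - alt A\<close> for \<open>n < A\<close>. For constants \<open>1 < c' < c\<close> ask, along a free
  ultrafilter, whether one is forced to meet a set \<open>A\<close> with \<open>\<parallel>alt A\<parallel> \<le> c'\<close> and
  \<open>\<parallel>x\<^sub>n - alt A\<parallel> \<ge> c\<close>. If so for most \<open>n\<close>, blocks \<open>alt B\<close> with \<open>min B = n\<close> can be chosen
  successively with separated differences. If not, for each pair of consecutive terms of a
  sequence \<open>c\<^sub>k\<close> decreasing from \<open>7/5\<close> to \<open>1\<close>, then along a subsequence all alternating sums are bounded
  by \<open>7/5\<close> (add the terms from right to left), and after further thinning the vectors
  \<open>x\<^sub>0 - x\<^sub>1 + \<dots> - x\<^sub>2\<^sub>k\<^sub>-\<^sub>1 - x\<^sub>2\<^sub>k\<close>, whose last sign is wrong, have norm at most \<open>19/10\<close>; their sums and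
  differences have leading coefficient \<open>\<plusminus>2\<close>.\<close>

section \<open>Distances and compactness in finitely generated spans\<close>

text \<open>The constant is the distance from \<open>y\<close> to the closed subspace, and
  homogeneity gives the factor \<open>\<bar>t\<bar>\<close>. It controls the coefficient of
  \<open>y\<close> in the two inductions that adjoin a vector to a finite spanning set.\<close>

lemma closed_span_distance:
  fixes y :: "'a::real_normed_vector"
  assumes "closed (span B)" "y \<notin> span B"
  obtains d where "0 < d" "\<And>e t. e \<in> span B \<Longrightarrow> \<bar>t\<bar> * d \<le> norm (e + t *\<^sub>R y)"
proof -
  define d where "d = infdist y (span B)"
  have "span B \<noteq> {}" using span_zero by blast
  then have d: "0 < d" unfolding d_def
    using infdist_pos_not_in_closed[OF assms(1) _ assms(2)] by simp
  have "\<bar>t\<bar> * d \<le> norm (e + t *\<^sub>R y)" if "e \<in> span B" for e t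
  proof (cases "t = 0")
    case False
    have "d \<le> dist y ((- 1 / t) *\<^sub>R e)"
      unfolding d_def using that by (intro infdist_le span_mul)
    then have "\<bar>t\<bar> * d \<le> norm (t *\<^sub>R (y - (- 1 / t) *\<^sub>R e))"
      by (simp add: dist_norm mult_left_mono)
    also have "t *\<^sub>R (y - (- 1 / t) *\<^sub>R e) = e + t *\<^sub>R y"
      using False by (simp add: algebra_simps)
    finally show ?thesis .
  qed simp
  with d show thesis by (rule that)
qed

text \<open>Along a convergent sequence the coefficients of the adjoined vector are Cauchy by the
  distance bound, so the limit splits in the same way as the terms.\<close>

lemma closed_span_finite:
  fixes B :: "'a::real_normed_vector set"
  assumes "finite B"
  shows "closed (span B)"
  using assms
proof (induction rule: finite_induct)
  case (insert y B)
  show ?case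
  proof (cases "y \<in> span B")
    case True
    then show ?thesis using insert by (simp add: span_redundant)
  next
    case False
    obtain d where d: "0 < d" and bound: "\<And>e t. e \<in> span B \<Longrightarrow> \<bar>t\<bar> * d \<le> norm (e + t *\<^sub>R y)"
      using closed_span_distance[OF insert.IH False] by blast
    show ?thesis
      unfolding closed_sequential_limits
    proof (intro allI impI, elim conjE)
      fix z l assume z: "\<forall>n. z n \<in> span (insert y B)" and l: "z \<longlonglongrightarrow> l"
      then obtain t where t: "\<And>n. z n - t n *\<^sub>R y \<in> span B"
        unfolding span_insert by (auto dest!: choice)
      have diff: "\<bar>t n - t m\<bar> * d \<le> norm (z n - z m)" for n m
        using bound[OF span_diff[OF t[of n] t[of m]], of "t n - t m"] by (simp add: algebra_simps)
      have "Cauchy t"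
      proof (rule metric_CauchyI)
        fix e :: real assume "0 < e"
        then obtain M where M: "\<And>m n. m \<ge> M \<Longrightarrow> n \<ge> M \<Longrightarrow> norm (z m - z n) < e * d"
          using LIMSEQ_imp_Cauchy[OF l] d unfolding Cauchy_iff by (metis mult_pos_pos)
        have "dist (t m) (t n) < e" if "m \<ge> M" "n \<ge> M" for m n
          using diff[of m n] M[OF that] d by (simp add: dist_real_def) (smt (verit) mult_less_cancel_right_pos)
        then show "\<exists>M. \<forall>m\<ge>M. \<forall>n\<ge>M. dist (t m) (t n) < e" by blast
      qed
      then obtain s where "t \<longlonglongrightarrow> s" using Cauchy_convergent convergent_def by blast
      then have "(\<lambda>n. z n - t n *\<^sub>R y) \<longlonglongrightarrow> l - s *\<^sub>R y"
        using l by (intro tendsto_intros)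
      then have "l - s *\<^sub>R y \<in> span B"
        by (rule closed_sequentially[OF insert.IH t])
      then show "l \<in> span (insert y B)" unfolding span_insert by blast
    qed
  qed
qed simp

lemma compact_span_cball:
  fixes B :: "'a::real_normed_vector set"
  assumes "finite B"
  shows "compact (span B \<inter> cball 0 r)"
  using assms
proof (induction arbitrary: r rule: finite_induct)
  case (insert y B)
  show ?case
  proof (cases "y \<in> span B")
    case True
    then show ?thesis using insert by (simp add: span_redundant)
  next
    case False
    obtain d where d: "0 < d" and bound: "\<And>e t. e \<in> span B \<Longrightarrow> \<bar>t\<bar> * d \<le> norm (e + t *\<^sub>R y)"
      using closed_span_distance[OF closed_span_finite[OF insert.hyps(1)] False] by blast
    \<comment> \<open>The distance bound gives \<open>\<bar>t\<bar> \<le> r / d\<close>, and the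
      triangle inequality then bounds the part in \<open>span B\<close>; hence \<open>K\<close>
      contains the ball.\<close>
    define K where "K = (\<lambda>(e, t). e + t *\<^sub>R y) ` ((span B \<inter> cball 0 (r + r / d * norm y)) \<times> {- (r / d)..r / d})"
    have "compact K"
      unfolding K_def using insert.IH
      by (intro compact_continuous_image compact_Times) (auto simp: case_prod_beta intro!: continuous_intros)
    moreover have "span (insert y B) \<inter> cball 0 r \<subseteq> K"
    proof
      fix z assume z: "z \<in> span (insert y B) \<inter> cball 0 r"
      then obtain t where t: "z - t *\<^sub>R y \<in> span B" by (auto simp: span_insert)
      have "\<bar>t\<bar> * d \<le> r" using bound[OF t, of t] z by simp
      then have "\<bar>t\<bar> \<le> r / d" using d by (simp add: field_simps)
      moreover have "norm (z - t *\<^sub>R y) \<le> r + r / d * norm y"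
        using norm_triangle_ineq4[of z "t *\<^sub>R y"] z mult_right_mono[OF \<open>\<bar>t\<bar> \<le> r / d\<close>, of "norm y"]
        by simp
      ultimately show "z \<in> K"
        unfolding K_def using t by (intro image_eqI[of _ _ "(z - t *\<^sub>R y, t)"]) auto
    qed
    moreover have "closed (span (insert y B) \<inter> cball 0 r)"
      using insert.hyps by (intro closed_Int closed_span_finite) auto
    ultimately show ?thesis by (metis compact_Int_closed inf.absorb_iff2)
  qed
qed (auto simp: Int_insert_left)

lemma compact_finite_net:
  fixes K :: "'a::metric_space set"
  assumes "compact K" "0 < e"
  obtains G where "finite G" "\<And>x. x \<in> K \<Longrightarrow> \<exists>g\<in>G. dist x g < e"
proof -
  obtain G where "finite G" "K \<subseteq> (\<Union>g\<in>G. ball g e)"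
    using assms compact_eq_totally_bounded[of K] by blast
  then show thesis by (intro that[of G]) (auto simp: subset_iff dist_commute)
qed

section \<open>Symmetric separation from blocks with separated differences\<close>

text \<open>It depends on the type alone, so that its negation can be carried as a hypothesis
  through the choice of blocks.\<close>

definition symmetrically_separable :: "'a::real_normed_vector itself \<Rightarrow> bool" where
  "symmetrically_separable _ \<longleftrightarrow>
     (\<exists>\<epsilon>>0. \<exists>x :: nat \<Rightarrow> 'a. range x \<subseteq> cball 0 1 \<and> symmetrically_separated (1 + \<epsilon>) x)"

lemma symmetrically_separableI:
  fixes x :: "nat \<Rightarrow> 'a::real_normed_vector"
  assumes "0 < e" and "\<And>n. norm (x n) \<le> 1"
    and "\<And>n k. n < k \<Longrightarrow> 1 + e \<le> norm (x n + x k)"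
    and "\<And>n k. n < k \<Longrightarrow> 1 + e \<le> norm (x n - x k)"
  shows "symmetrically_separable TYPE('a)"
proof -
  have "1 + e \<le> norm (x n + x k) \<and> 1 + e \<le> norm (x n - x k)" if "n \<noteq> k" for n k
    using that assms(3,4)[of n k] assms(3,4)[of k n]
    by (cases "n < k") (auto simp: norm_minus_commute add.commute)
  then show ?thesis
    unfolding symmetrically_separable_def symmetrically_separated_def
    using assms(1,2) by (intro exI[of _ e] conjI exI[of _ x]) auto
qed

text \<open>Basic sequences, possibly with zero terms, whose initial projections have constants tending to 1.\<close>

definition tail_basic :: "(nat \<Rightarrow> 'a::real_normed_vector) \<Rightarrow> bool" where
  "tail_basic x \<longleftrightarrow>
     (\<forall>\<delta>>0. \<exists>n0. \<forall>n\<ge>n0. \<forall>a\<in>span (x ` {..<n}). \<forall>b\<in>span (x ` {n..}).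
        norm a \<le> (1 + \<delta>) * norm (a + b))"

lemma tail_basicE:
  assumes "tail_basic x" "0 < d"
  obtains n0 where "\<And>n a b. n \<ge> n0 \<Longrightarrow> a \<in> span (x ` {..<n}) \<Longrightarrow> b \<in> span (x ` {n..}) \<Longrightarrow>
    norm a \<le> (1 + d) * norm (a + b)"
  using assms unfolding tail_basic_def by blast

text \<open>Cutting the blocks at \<open>n\<close> cuts \<open>x\<close> at \<open>s n\<close>, and
  \<open>n \<le> s n\<close>, so the same threshold serves.\<close>

lemma tail_basic_block:
  assumes x: "tail_basic x" and s: "strict_mono s"
    and p: "\<And>l. p l \<in> span (x ` {s l..<s (Suc l)})"
  shows "tail_basic p"
  unfolding tail_basic_def
proof (intro allI impI)
  fix d :: real assume "0 < d"
  then obtain n0 where n0: "\<And>n a b. n \<ge> n0 \<Longrightarrow> a \<in> span (x ` {..<n}) \<Longrightarrow> b \<in> span (x ` {n..}) \<Longrightarrow>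
    norm a \<le> (1 + d) * norm (a + b)"
    using tail_basicE[OF x] by metis
  have "norm a \<le> (1 + d) * norm (a + b)"
    if n: "n \<ge> n0" and a: "a \<in> span (p ` {..<n})" and b: "b \<in> span (p ` {n..})" for n a b
  proof (rule n0[of "s n"])
    show "n0 \<le> s n" using n seq_suble[OF s, of n] by simp
    have "p ` {..<n} \<subseteq> span (x ` {..<s n})"
    proof clarify
      fix l assume "l < n"
      then have "s (Suc l) \<le> s n" using s by (simp add: strict_mono_less_eq)
      then have "span (x ` {s l..<s (Suc l)}) \<subseteq> span (x ` {..<s n})"
        by (intro span_mono image_mono) auto
      with p show "p l \<in> span (x ` {..<s n})" by blast
    qed
    with a show "a \<in> span (x ` {..<s n})" using span_minimal[OF _ subspace_span] by blast
    have "p ` {n..} \<subseteq> span (x ` {s n..})"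
    proof clarify
      fix l assume "n \<le> l"
      then have "s n \<le> s l" using s by (simp add: strict_mono_less_eq)
      then have "span (x ` {s l..<s (Suc l)}) \<subseteq> span (x ` {s n..})"
        by (intro span_mono image_mono) auto
      with p show "p l \<in> span (x ` {s n..})" by blast
    qed
    with b show "b \<in> span (x ` {s n..})" using span_minimal[OF _ subspace_span] by blast
  qed
  then show "\<exists>n0. \<forall>n\<ge>n0. \<forall>a\<in>span (p ` {..<n}). \<forall>b\<in>span (p ` {n..}). norm a \<le> (1 + d) * norm (a + b)"
    by blast
qed

lemma tail_basic_subseq:
  assumes "tail_basic x" "strict_mono f"
  shows "tail_basic (x \<circ> f)"
  by (rule tail_basic_block[OF assms])
    (use assms(2) in \<open>auto intro!: span_base simp: strict_mono_less\<close>)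

text \<open>Ramsey's theorem colours pairs by whether their sum is large. If sums are large, a
  subsequence works. Otherwise one term is added to all later ones: it cancels in differences and
  doubles in sums.\<close>

lemma separated_differences:
  fixes u :: "nat \<Rightarrow> 'a::real_normed_vector"
  assumes u: "tail_basic u" and u1: "\<And>k. norm (u k) \<le> 1" and e: "0 < e"
    and sep: "\<And>k m. k < m \<Longrightarrow> 1 + e \<le> norm (u k - u m)"
  shows "symmetrically_separable TYPE('a)"
proof -
  have sep': "1 + e \<le> norm (u k - u m)" if "k \<noteq> m" for k m
    using sep[of k m] sep[of m k] that by (cases "k < m") (auto simp: norm_minus_commute)
  have "norm (u 0 - u 1) \<le> 2"
    using norm_triangle_ineq4[of "u 0" "u 1"] u1[of 0] u1[of 1] by linarith
  with sep[of 0 1] have e1: "e \<le> 1" by simp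
  \<comment> \<open>As \<open>e \<le> 1\<close>, the cube of \<open>1 + d\<close> is at most
    \<open>1 + e\<close>: one factor pays for the basis constant, one for the scaling, and one is
    the separation achieved.\<close>
  define d where "d = e / 5"
  have d: "0 < d" "d \<le> 1/5" "e = 5 * d" using e e1 by (auto simp: d_def)
  have "d * d \<le> (1/5) * d" "d * d * d \<le> (1/5) * (1/5) * d"
    using d by (intro mult_right_mono mult_mono; simp)+
  moreover have "(1 + d) * ((1 + d) * (1 + d)) = 1 + 3 * d + 3 * (d * d) + d * d * d"
    by (simp add: algebra_simps)
  ultimately have cube: "(1 + d) * ((1 + d) * (1 + d)) \<le> 1 + e"
    using d by linarith
  have square: "(1 + d) * (1 + d) \<le> 1 + e"
    using \<open>d * d \<le> (1/5) * d\<close> d by (simp add: algebra_simps)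
  obtain n0 where n0: "\<And>n a b. n \<ge> n0 \<Longrightarrow> a \<in> span (u ` {..<n}) \<Longrightarrow> b \<in> span (u ` {n..}) \<Longrightarrow>
    norm a \<le> (1 + d) * norm (a + b)"
    using tail_basicE[OF u d(1)] by metis
  define f where "f X = (if 1 + d \<le> norm (sum u X) then 1 else 0 :: nat)" for X
  have "\<exists>Y t. Y \<subseteq> {n0..} \<and> infinite Y \<and> t < 2 \<and> (\<forall>x\<in>Y. \<forall>y\<in>Y. x \<noteq> y \<longrightarrow> f {x, y} = t)"
    by (rule Ramsey2[of "{n0..}" f 2]) (simp_all add: f_def infinite_Ici)
  then obtain Y t where Y: "Y \<subseteq> {n0..}" "infinite Y"
    and "\<forall>x\<in>Y. \<forall>y\<in>Y. x \<noteq> y \<longrightarrow> f {x, y} = t" by (elim exE conjE) (rule that)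
  then have t: "f {x, y} = t" if "x \<in> Y" "y \<in> Y" "x \<noteq> y" for x y
    using that by simp
  have f: "f {i, j} = (if 1 + d \<le> norm (u i + u j) then 1 else 0)" if "i \<noteq> j" for i j
    using that by (simp add: f_def)
  define r where "r = enumerate Y"
  have r: "strict_mono r" "\<And>k. r k \<in> Y"
    unfolding r_def using Y by (auto simp: strict_mono_enumerate enumerate_in_set)
  have rlt: "r i < r j \<longleftrightarrow> i < j" for i j using r(1) by (simp add: strict_mono_less)
  show ?thesis
  proof (cases "t = 1")
    case True
    show ?thesis
    proof (rule symmetrically_separableI[of d "u \<circ> r"])
      fix n k :: nat assume "n < k"
      then have "r n \<noteq> r k" using rlt[of n k] by auto
      then have "1 + d \<le> norm (u (r n) + u (r k))"
        using t[OF r(2) r(2), of n k] f[of "r n" "r k"] True by (metis zero_neq_one)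
      then show "1 + d \<le> norm ((u \<circ> r) n + (u \<circ> r) k)" by simp
      have "1 + d \<le> norm (u (r n) - u (r k))"
        using sep'[OF \<open>r n \<noteq> r k\<close>] d by linarith
      then show "1 + d \<le> norm ((u \<circ> r) n - (u \<circ> r) k)" by simp
    qed (simp_all add: u1 d(1))
  next
    case False
    have small: "norm (u i + u j) \<le> 1 + d" if "i \<in> Y" "j \<in> Y" "i \<noteq> j" for i j
      using t[OF that] False f[OF that(3)] by (metis linear)
    \<comment> \<open>One of two separated vectors has norm at least half of \<open>1 + e\<close>.
      It is sought among the first two, whence the shift by 2 in the later indices.\<close>
    have "1 + e \<le> norm (u (r 0)) + norm (u (r 1))"
      using sep[of "r 0" "r 1"] rlt norm_triangle_ineq4[of "u (r 0)" "u (r 1)"] by fastforce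
    then obtain i where i: "i \<in> {r 0, r 1}" "1 + e \<le> norm (2 *\<^sub>R u i)"
      by (cases "norm (u (r 0)) \<ge> norm (u (r 1))") fastforce+
    have iY: "i \<in> Y" and ir: "\<And>m. i < r (m + 2)" and "n0 \<le> i"
      using i r(2) rlt Y(1) by auto
    define y where "y m = (1 / (1 + d)) *\<^sub>R (u i + u (r (m + 2)))" for m
    show ?thesis
    proof (rule symmetrically_separableI[of d y])
      show "norm (y n) \<le> 1" for n
        using small[OF iY r(2), of "n + 2"] ir[of n] d(1)
        unfolding y_def norm_scaleR by simp
    next
      fix n k :: nat assume "n < k"
      then have ne: "r (n + 2) < r (k + 2)" by (simp add: rlt)
      have "(1 + d) * ((1 + d) * (1 + d)) \<le> norm (2 *\<^sub>R u i)" using cube i by linarith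
      also have "\<dots> \<le> (1 + d) * norm (2 *\<^sub>R u i + (u (r (n + 2)) + u (r (k + 2))))"
      proof (rule n0[of "Suc i"])
        show "2 *\<^sub>R u i \<in> span (u ` {..<Suc i})"
          by (intro span_mul span_base) auto
        show "u (r (n + 2)) + u (r (k + 2)) \<in> span (u ` {Suc i..})"
          using ir[of n] ir[of k] by (intro span_add span_base) auto
      qed (use \<open>n0 \<le> i\<close> in auto)
      also have "\<dots> = (1 + d) * ((1 + d) * norm (y n + y k))"
      proof -
        have "2 *\<^sub>R u i + (u (r (n + 2)) + u (r (k + 2))) = (1 + d) *\<^sub>R (y n + y k)"
          using d by (simp add: y_def scaleR_add_right scaleR_2)
        then show ?thesis using d by simp
      qed
      finally show "1 + d \<le> norm (y n + y k)"
        using d by (simp only: mult_le_cancel_left_pos)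
      have "u (r (n + 2)) - u (r (k + 2)) = (1 + d) *\<^sub>R (y n - y k)"
        using d by (simp add: y_def scaleR_diff_right scaleR_add_right)
      then have "norm (u (r (n + 2)) - u (r (k + 2))) = (1 + d) * norm (y n - y k)"
        using d by simp
      then have "(1 + d) * (1 + d) \<le> (1 + d) * norm (y n - y k)"
        using sep[OF ne] square by linarith
      then show "1 + d \<le> norm (y n - y k)"
        using d by (simp only: mult_le_cancel_left_pos)
    qed (use d in auto)
  qed
qed

section \<open>Extending blocks when no symmetrically separated sequence exists\<close>

text \<open>If \<open>g t\<close> lies beyond a block chosen from \<open>t\<close> on, the blocks
  chosen at \<open>T 0\<close>, \<open>T 1\<close> and so on are successive.\<close>

lemma iterate_strict_mono:
  fixes g :: "nat \<Rightarrow> nat"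
  assumes "\<And>t. t < g t"
  obtains T where "T 0 = m" "strict_mono T" "\<And>k. T (Suc k) = g (T k)"
proof -
  define T where "T = rec_nat m (\<lambda>_. g)"
  have T: "T 0 = m" "\<And>k. T (Suc k) = g (T k)" by (simp_all add: T_def)
  then have "strict_mono T" using assms by (intro strict_monoI_Suc) simp
  with T show thesis by (intro that[of T])
qed

text \<open>Otherwise one could pick successive finite sets \<open>X\<close> whose vectors \<open>V X\<close> have separated differences:
  the leading term of each later \<open>V X\<close> alone is already far from the earlier vectors.\<close>

lemma extendable:
  fixes p :: "nat \<Rightarrow> 'a::real_normed_vector" and V :: "nat set \<Rightarrow> 'a"
  assumes p: "tail_basic p" and nonsep: "\<not> symmetrically_separable TYPE('a)"
    and V: "\<And>X. finite X \<Longrightarrow> X \<noteq> {} \<Longrightarrow> V X - p (Min X) \<in> span (p ` {Min X<..Max X})"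
    and b: "0 < b" "b < b'"
  shows "\<exists>t. \<forall>X. finite X \<longrightarrow> X \<noteq> {} \<longrightarrow> X \<subseteq> {t..} \<longrightarrow> norm (V X) \<le> b \<longrightarrow>
    infinite {m. norm (V X - p m) \<le> b'}"
proof (rule ccontr)
  assume "\<not> ?thesis"
  then have "\<forall>t. \<exists>X. finite X \<and> X \<noteq> {} \<and> X \<subseteq> {t..} \<and> norm (V X) \<le> b \<and>
    finite {m. norm (V X - p m) \<le> b'}" by blast
  then obtain X where X: "\<And>t. finite (X t)" "\<And>t. X t \<noteq> {}" "\<And>t. X t \<subseteq> {t..}"
      "\<And>t. norm (V (X t)) \<le> b" and fin: "\<And>t. finite {m. norm (V (X t) - p m) \<le> b'}"
    by metis
  \<comment> \<open>This makes \<open>(1 + d) * b\<close> the midpoint of \<open>b\<close> and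
    \<open>b'\<close>, leaving room for the basis constant.\<close>
  define d where "d = (b' - b) / (2 * b)"
  have d: "0 < d" "(1 + d) * b < b'" using b by (auto simp: d_def field_simps)
  obtain n0 where n0: "\<And>n a c. n \<ge> n0 \<Longrightarrow> a \<in> span (p ` {..<n}) \<Longrightarrow> c \<in> span (p ` {n..}) \<Longrightarrow>
    norm a \<le> (1 + d) * norm (a + c)"
    using tail_basicE[OF p d(1)] by metis
  \<comment> \<open>From \<open>g t\<close> on there are neither indices of \<open>X t\<close> nor
    indices \<open>m\<close> with \<open>p m\<close> close to \<open>V (X t)\<close>.\<close>
  define g where "g t = Suc (Max (X t \<union> {m. norm (V (X t) - p m) \<le> b'}))" for t
  have gX: "m < g t" if "m \<in> X t" for m t
    using X(1) fin that by (auto simp: g_def less_Suc_eq_le intro!: Max_ge)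
  have gb: "b' < norm (V (X t) - p m)" if "g t \<le> m" for m t
  proof (rule ccontr)
    assume "\<not> ?thesis"
    then have "m \<le> Max (X t \<union> {m. norm (V (X t) - p m) \<le> b'})"
      using X(1) fin by (intro Max_ge) auto
    with that show False by (simp add: g_def)
  qed
  have "t < g t" for t
    using X(2,3)[of t] gX[of _ t] by (meson atLeast_iff ex_in_conv le_less_trans subsetD)
  then obtain T where T0: "T 0 = n0" and T: "strict_mono T" and TS: "\<And>k. T (Suc k) = g (T k)"
    by (rule iterate_strict_mono) (rule that)
  have VX: "V (X t) \<in> span (p ` {t..<g t})" for t
  proof -
    have M: "Min (X t) \<in> X t" "Max (X t) \<in> X t" using X by auto
    have "p (Min (X t)) \<in> span (p ` {t..<g t})"
      using M gX X(3)[of t] by (intro span_base) auto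
    moreover have "span (p ` {Min (X t)<..Max (X t)}) \<subseteq> span (p ` {t..<g t})"
      using M gX[OF M(2)] X(3)[of t] by (intro span_mono image_mono) auto
    ultimately show ?thesis
      using V[OF X(1,2), of t] by (metis diff_add_cancel span_add subsetD)
  qed
  define u where "u k = (1 / b) *\<^sub>R V (X (T k))" for k
  have "tail_basic u"
    using VX by (intro tail_basic_block[OF p T]) (auto simp: u_def TS intro: span_mul)
  moreover have "norm (u k) \<le> 1" for k using X(4) b by (simp add: u_def field_simps)
  moreover define e where "e = b' / ((1 + d) * b) - 1"
  moreover have "0 < e" using d b mult_pos_pos[of "1 + d" b] by (simp add: e_def less_divide_eq del: distrib_right)
  moreover have "1 + e \<le> norm (u k - u m)" if "k < m" for k m
  proof -
    define j where "j = Min (X (T m))"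
    have jX: "j \<in> X (T m)" unfolding j_def using X by auto
    then have Tj: "T m \<le> j" using X(3) by auto
    have Tk: "g (T k) \<le> T m"
      using that T by (metis Suc_leI TS strict_mono_less_eq)
    have "b' < norm (V (X (T k)) - p j)" using gb Tk Tj by auto
    \<comment> \<open>The cut just after \<open>j\<close> keeps only the leading term of the later
      vector; restoring the other terms costs a factor \<open>1 + d\<close>.\<close>
    also have "\<dots> \<le> (1 + d) * norm ((V (X (T k)) - p j) + (p j - V (X (T m))))"
    proof (rule n0[of "Suc j"])
      show "n0 \<le> Suc j" using Tj T T0 by (metis le0 le_Suc_eq le_trans strict_mono_less_eq)
      have "span (p ` {T k..<g (T k)}) \<subseteq> span (p ` {..<Suc j})"
        using Tk Tj by (intro span_mono image_mono) auto
      then show "V (X (T k)) - p j \<in> span (p ` {..<Suc j})"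
        using VX by (intro span_diff) (auto intro: span_base)
      have "span (p ` {j<..Max (X (T m))}) \<subseteq> span (p ` {Suc j..})"
        by (intro span_mono image_mono) auto
      then have "- (V (X (T m)) - p j) \<in> span (p ` {Suc j..})"
        using V[OF X(1,2), of "T m"] unfolding j_def[symmetric] by (intro span_neg) auto
      then show "p j - V (X (T m)) \<in> span (p ` {Suc j..})" by simp
    qed
    also have "\<dots> = (1 + d) * b * norm (u k - u m)"
      using b by (simp add: u_def scaleR_diff_right[symmetric])
    finally show ?thesis
      using b d mult_pos_pos[of "1 + d" b] by (simp add: e_def divide_le_eq mult.commute)
  qed
  ultimately show False using nonsep separated_differences by blast
qed

text \<open>Repeated extension bounds some \<open>w\<^sub>a - w\<^sub>b - w\<^sub>c - \<dots>\<close> with arbitrarily many terms.\<close>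

lemma small_average:
  fixes w :: "nat \<Rightarrow> 'a::real_normed_vector" and d :: real
  assumes w: "tail_basic w" and nonsep: "\<not> symmetrically_separable TYPE('a)"
    and R: "0 < R" "\<And>l. norm (w l) \<le> R" and d: "0 < d"
  shows "\<exists>K. finite K \<and> K \<noteq> {} \<and> norm (sum w K) \<le> d * card K"
proof -
  \<comment> \<open>Appending an index \<open>m\<close> above \<open>X\<close> subtracts
    \<open>w m\<close>, which is the operation that \<open>extendable\<close> bounds.\<close>
  define V where "V X = w (Min X) - sum w (X - {Min X})" for X
  obtain L :: nat where L: "4 * R \<le> d * L" "0 < L"
  proof -
    obtain L :: nat where "4 * R / d < L" using reals_Archimedean2 by blast
    with d R show thesis by (intro that[of L]) (auto simp: field_simps intro: gr0I)
  qed
  \<comment> \<open>The bounds rise from \<open>R\<close>, valid for singletons, to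
    \<open>2 * R\<close> after \<open>L\<close> extensions, independently of
    \<open>L\<close>.\<close>
  define b where "b l = R * (1 + l / L)" for l :: nat
  have b: "0 < b l" "b l < b (Suc l)" for l
    using R L by (auto simp: b_def field_simps add_pos_nonneg)
  have V': "V X - w (Min X) \<in> span (w ` {Min X<..Max X})" if "finite X" "X \<noteq> {}" for X
  proof -
    have "sum w (X - {Min X}) \<in> span (w ` {Min X<..Max X})"
      using that Min_le[of X] Max_ge[of X] by (intro span_sum span_base) (auto simp: le_neq_implies_less)
    then show ?thesis using span_neg by (fastforce simp: V_def)
  qed
  have "\<exists>t. \<forall>X. finite X \<longrightarrow> X \<noteq> {} \<longrightarrow> X \<subseteq> {t..} \<longrightarrow> norm (V X) \<le> b l \<longrightarrow>
      infinite {m. norm (V X - w m) \<le> b (Suc l)}" for l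
    by (rule extendable[OF w nonsep V' b])
  then obtain t where t: "\<And>l X. finite X \<Longrightarrow> X \<noteq> {} \<Longrightarrow> X \<subseteq> {t l..} \<Longrightarrow> norm (V X) \<le> b l \<Longrightarrow>
      infinite {m. norm (V X - w m) \<le> b (Suc l)}" by metis
  define t' where "t' = Max (t ` {..L})"
  have t': "t l \<le> t'" if "l \<le> L" for l using that by (auto simp: t'_def)
  have "\<exists>X. finite X \<and> card X = Suc l \<and> X \<subseteq> {t'..} \<and> norm (V X) \<le> b l" if "l \<le> L" for l
    using that
  proof (induction l)
    case 0
    then show ?case using R by (intro exI[of _ "{t'}"]) (auto simp: V_def b_def)
  next
    case (Suc l)
    then obtain X where X: "finite X" "card X = Suc l" "X \<subseteq> {t'..}" "norm (V X) \<le> b l" by auto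
    then have ne: "X \<noteq> {}" by auto
    have "X \<subseteq> {t l..}" using X(3) t'[of l] Suc.prems by auto
    then obtain m where m: "Max X < m" "norm (V X - w m) \<le> b (Suc l)"
      using t[OF X(1) ne _ X(4)] by (metis (mono_tags, lifting) infinite_nat_iff_unbounded mem_Collect_eq)
    have mX: "\<And>i. i \<in> X \<Longrightarrow> i < m" using m(1) X(1) by (meson Max_ge le_less_trans)
    have Min: "Min (insert m X) = Min X"
      using X(1) ne mX by (simp add: Min_insert min_def) (meson Min_in leD)
    have "insert m X - {Min X} = insert m (X - {Min X})"
      using mX Min_in[OF X(1) ne] by auto
    moreover have "m \<notin> X" using mX by blast
    ultimately have "V (insert m X) = V X - w m"
      using X(1) by (simp add: V_def Min)
    with m X(1,2) \<open>m \<notin> X\<close> X(3) mX ne show ?case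
      by (intro exI[of _ "insert m X"]) (auto, meson atLeast_iff ex_in_conv le_trans less_imp_le subsetD)
  qed
  then obtain X where X: "finite X" "card X = Suc L" "norm (V X) \<le> b L" by blast
  define K where "K = X - {Min X}"
  have "X \<noteq> {}" using X by auto
  then have K: "finite K" "card K = L" using X by (auto simp: K_def)
  \<comment> \<open>Removing the leading term leaves \<open>L\<close> terms whose sum has norm at
    most \<open>3 * R\<close>, below \<open>d * L\<close> by the choice of \<open>L\<close>.\<close>
  have "sum w K = w (Min X) - V X" by (simp add: V_def K_def)
  then have "norm (sum w K) \<le> R + b L"
    using norm_triangle_ineq4[of "w (Min X)" "V X"] R(2)[of "Min X"] X(3) by simp
  also have "\<dots> \<le> d * card K" using L R K by (simp add: b_def)
  finally show ?thesis using K L by (intro exI[of _ K]) auto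
qed

section \<open>Existence of a normalized tail-basic sequence\<close>

text \<open>Riesz's lemma with constant 1/2, applied successively to the spans of the vectors
  already chosen.\<close>

lemma infinite_dimensional_separated:
  assumes inf: "\<not> (\<exists>B :: 'a::real_normed_vector set. finite B \<and> span B = UNIV)"
  shows "\<exists>v :: nat \<Rightarrow> 'a. (\<forall>n. norm (v n) = 1) \<and> (\<forall>i j. i < j \<longrightarrow> 1/2 \<le> norm (v i - v j))"
proof -
  have "\<exists>w :: 'a. norm w = 1 \<and> (\<forall>b\<in>span B. 1/2 \<le> norm (b - w))" if B: "finite B" for B
  proof -
    obtain z where z: "z \<notin> span B" using inf B by blast
    define d where "d = infdist z (span B)"
    have ne: "span B \<noteq> {}" using span_zero by blast
    then have d: "0 < d" unfolding d_def
      using infdist_pos_not_in_closed[OF closed_span_finite[OF B] _ z] by simp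
    have "\<exists>e\<in>span B. dist z e < 2 * d"
    proof (rule ccontr)
      assume "\<not> ?thesis"
      then have "2 * d \<le> infdist z (span B)"
        unfolding infdist_notempty[OF ne] by (intro cINF_greatest ne) auto
      with d show False by (simp add: d_def)
    qed
    then obtain e where e: "e \<in> span B" "norm (z - e) < 2 * d" by (auto simp: dist_norm)
    define c where "c = norm (z - e)"
    have c: "0 < c" "c < 2 * d" using e z by (auto simp: c_def)
    have "1/2 \<le> norm (b - (1 / c) *\<^sub>R (z - e))" if b: "b \<in> span B" for b
    proof -
      \<comment> \<open>Multiplication by \<open>c\<close> turns the distance in question into one
        from \<open>z\<close> to a point of \<open>span B\<close>; it is at least \<open>d\<close>,
        hence more than \<open>c / 2\<close>.\<close>
      have "d \<le> dist z (e + c *\<^sub>R b)"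
        unfolding d_def using e b by (intro infdist_le span_add span_mul)
      also have "\<dots> = norm (c *\<^sub>R (b - (1 / c) *\<^sub>R (z - e)))"
        using c by (simp add: dist_norm scaleR_diff_right norm_minus_commute algebra_simps)
      finally have "d \<le> c * norm (b - (1 / c) *\<^sub>R (z - e))" using c by simp
      then have "c / 2 \<le> c * norm (b - (1 / c) *\<^sub>R (z - e))" using c by linarith
      then show ?thesis using c by simp
    qed
    moreover have "norm ((1 / c) *\<^sub>R (z - e)) = 1" using c by (simp add: c_def)
    ultimately show ?thesis by blast
  qed
  then obtain W where W: "\<And>B :: 'a set. finite B \<Longrightarrow> norm (W B) = 1"
      "\<And>B b. finite B \<Longrightarrow> b \<in> span B \<Longrightarrow> 1/2 \<le> norm (b - W B)" by metis
  have "\<exists>v :: nat \<Rightarrow> 'a. \<forall>n. v n = W (v ` {..<n})"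
    by (rule dependent_wf_choice[where P = "\<lambda>v n r. r = W (v ` {..<n})", OF wf_less_than])
      (auto cong: image_cong_simp)
  then obtain v :: "nat \<Rightarrow> 'a" where v: "\<And>n. v n = W (v ` {..<n})" by blast
  have "norm (v n) = 1" for n using W(1)[of "v ` {..<n}"] v[of n] by simp
  moreover have "1/2 \<le> norm (v i - v j)" if "i < j" for i j
    using W(2)[of "v ` {..<j}" "v i"] v[of j] that by (auto intro: span_base)
  ultimately show ?thesis by blast
qed

text \<open>A telescoping average over a homogeneous set replaces the norming functionals of Mazur's
  argument, so that no Hahn--Banach theorem is needed.\<close>

lemma almost_orthogonal_difference:
  fixes v :: "nat \<Rightarrow> 'a::real_normed_vector"
  assumes v: "\<And>n. norm (v n) \<le> 1" and P: "finite (P :: ('a \<times> real) set)" and e: "0 < e"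
  shows "\<exists>i j. i < j \<and> (\<forall>q\<in>P. norm (fst q) - e \<le> norm (fst q + snd q *\<^sub>R (v i - v j)))"
proof (rule ccontr)
  assume "\<not> ?thesis"
  then have "\<forall>i j. i < j \<longrightarrow> (\<exists>q\<in>P. norm (fst q + snd q *\<^sub>R (v i - v j)) < norm (fst q) - e)"
    by (meson not_le)
  then obtain q where q: "\<And>i j. i < j \<Longrightarrow> q i j \<in> P"
      "\<And>i j. i < j \<Longrightarrow> norm (fst (q i j) + snd (q i j) *\<^sub>R (v i - v j)) < norm (fst (q i j)) - e"
    by metis
  obtain h and N :: nat where h: "h ` P = {i. i < N}" "inj_on h P"
    using finite_imp_inj_to_nat_seg[OF P] by blast
  \<comment> \<open>The colour of a pair is the number of a member of \<open>P\<close> that violates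
    the claim for its two indices in increasing order.\<close>
  define f where "f X = h (q (Min X) (Max X))" for X
  have f: "f {i, j} = h (q i j)" if "i < j" for i j
    using that by (simp add: f_def min_def max_def)
  have "f {i, j} < N" if "i \<noteq> j" for i j
    using that q(1)[of i j] q(1)[of j i] f[of i j] f[of j i] h(1)
    by (cases "i < j") (auto simp: insert_commute)
  then have "\<exists>Y c. Y \<subseteq> UNIV \<and> infinite Y \<and> c < N \<and> (\<forall>x\<in>Y. \<forall>y\<in>Y. x \<noteq> y \<longrightarrow> f {x, y} = c)"
    by (intro Ramsey2[of UNIV f N]) auto
  then obtain Y c where Y: "infinite Y" and "\<forall>x\<in>Y. \<forall>y\<in>Y. x \<noteq> y \<longrightarrow> f {x, y} = c"
    by (elim exE conjE) (rule that)
  then have c: "f {x, y} = c" if "x \<in> Y" "y \<in> Y" "x \<noteq> y" for x y using that by simp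
  define r where "r = enumerate Y"
  have r: "r i < r j" if "i < j" for i j
    unfolding r_def using enumerate_mono[OF that Y] .
  have rY: "r i \<in> Y" for i unfolding r_def by (rule enumerate_in_set[OF Y])
  define g t where "g = fst (q (r 0) (r 1))" and "t = snd (q (r 0) (r 1))"
  have "q (r i) (r j) = (g, t)" if "i < j" for i j
  proof -
    have "h (q (r i) (r j)) = h (q (r 0) (r 1))"
      using c[OF rY rY, of i j] c[OF rY rY, of 0 1] f[OF r[OF that]] f[OF r, of 0 1] r[OF that] r[of 0 1]
      by simp
    then have "q (r i) (r j) = q (r 0) (r 1)"
      using h(2) q(1)[OF r[OF that]] q(1)[OF r, of 0 1] by (simp add: inj_on_eq_iff)
    then show ?thesis by (simp add: g_def t_def)
  qed
  then have gt: "norm (g + t *\<^sub>R (v (r k) - v (r (Suc k)))) \<le> norm g - e" for k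
    using q(2)[OF r, of k "Suc k"] by simp
  \<comment> \<open>One pair \<open>(g, t)\<close> is violated along the whole homogeneous set. The
    sum of \<open>L\<close> such vectors telescopes, so its norm is at least
    \<open>L * norm g - 2 * \<bar>t\<bar>\<close>, yet at most
    \<open>L * (norm g - e)\<close>.\<close>
  have "L * e \<le> \<bar>t\<bar> * 2" for L :: nat
  proof -
    have "(\<Sum>k<L. g + t *\<^sub>R (v (r k) - v (r (Suc k)))) = L *\<^sub>R g + t *\<^sub>R (v (r 0) - v (r L))"
      by (induction L) (simp_all add: algebra_simps)
    moreover have "norm (\<Sum>k<L. g + t *\<^sub>R (v (r k) - v (r (Suc k)))) \<le> L * (norm g - e)"
      using sum_norm_le[of "{..<L}", OF gt] by simp
    ultimately have "norm (L *\<^sub>R g + t *\<^sub>R (v (r 0) - v (r L))) \<le> L * (norm g - e)" by simp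
    moreover have "norm (t *\<^sub>R (v (r 0) - v (r L))) \<le> \<bar>t\<bar> * 2"
    proof -
      have "norm (v (r 0) - v (r L)) \<le> 2"
        using norm_triangle_ineq4[of "v (r 0)" "v (r L)"] v[of "r 0"] v[of "r L"] by linarith
      then show ?thesis by (simp add: mult_left_mono)
    qed
    moreover have "norm (L *\<^sub>R g) - norm (t *\<^sub>R (v (r 0) - v (r L))) \<le> norm (L *\<^sub>R g + t *\<^sub>R (v (r 0) - v (r L)))"
      by (rule norm_diff_ineq)
    ultimately show ?thesis by (simp add: algebra_simps)
  qed
  moreover obtain L :: nat where "\<bar>t\<bar> * 2 / e < L" using reals_Archimedean2 by blast
  then have "\<bar>t\<bar> * 2 < L * e" using e by (simp add: field_simps)
  ultimately show False by (meson not_le)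
qed

text \<open>By homogeneity \<open>e\<close> may have norm 1. For
  \<open>\<bar>t\<bar> \<le> 2\<close> finite nets leave finitely many pairs to treat; for larger
  \<open>t\<close> the triangle inequality suffices.\<close>

lemma almost_orthogonal_vector:
  assumes inf: "\<not> (\<exists>B :: 'a::real_normed_vector set. finite B \<and> span B = UNIV)"
    and B: "finite (B :: 'a set)" and d: "0 < d"
  shows "\<exists>y. norm y = 1 \<and> (\<forall>e\<in>span B. \<forall>t. (1 - d) * norm e \<le> norm (e + t *\<^sub>R y))"
proof -
  obtain v :: "nat \<Rightarrow> 'a" where v: "\<And>n. norm (v n) = 1" "\<And>i j. i < j \<Longrightarrow> 1/2 \<le> norm (v i - v j)"
    using infinite_dimensional_separated[OF inf] by blast
  \<comment> \<open>The loss \<open>d\<close> collects four errors of size \<open>h\<close>: two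
    from replacing the unit vector by a net point, one from replacing the coefficient, and one from
    \<open>almost_orthogonal_difference\<close>.\<close>
  define h where "h = d / 4"
  have h: "0 < h" "d = 4 * h" using d by (auto simp: h_def)
  obtain G where G: "finite G" "\<And>e. e \<in> span B \<inter> cball 0 1 \<Longrightarrow> \<exists>g\<in>G. dist e g < h"
    using compact_finite_net[OF compact_span_cball[OF B] h(1)] by metis
  \<comment> \<open>The range covers \<open>t / c\<close> for \<open>\<bar>t\<bar> \<le> 2\<close>
    and \<open>1/2 \<le> c\<close>; the mesh \<open>h / 2\<close> compensates for a difference
    \<open>v i - v j\<close> of norm up to 2.\<close>
  obtain T where T: "finite T" "\<And>t::real. t \<in> {-4..4} \<Longrightarrow> \<exists>s\<in>T. dist t s < h / 2"
    using compact_finite_net[OF compact_Icc, of "h / 2" "-4" "4"] h by (metis half_gt_zero)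
  obtain i j where "i < j"
    and ge: "\<forall>q\<in>G \<times> T. norm (fst q) - h \<le> norm (fst q + snd q *\<^sub>R (v i - v j))"
    using almost_orthogonal_difference[of v "G \<times> T" h] v(1) G(1) T(1) h(1) by auto
  have ij: "i < j" "norm g - h \<le> norm (g + t *\<^sub>R (v i - v j))" if "g \<in> G" "t \<in> T" for g t
    using \<open>i < j\<close> bspec[OF ge, of "(g, t)"] that by simp_all
  define z c where "z = v i - v j" and "c = norm z"
  have c: "1/2 \<le> c" "c \<le> 2"
    using v(2)[OF \<open>i < j\<close>] norm_triangle_ineq4[of "v i" "v j"] v(1) by (auto simp: c_def z_def)
  define y where "y = (1 / c) *\<^sub>R z"
  have y: "norm y = 1" using c by (simp add: y_def flip: c_def)
  have unit: "1 - d \<le> norm (e + t *\<^sub>R y)" if e: "e \<in> span B" "norm e = 1" for e t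
  proof (cases "\<bar>t\<bar> \<le> 2")
    case True
    have "\<bar>t / c\<bar> \<le> 4"
      using True c by (simp add: abs_divide divide_le_eq)
    then have "t / c \<in> {-4..4}" unfolding abs_le_iff by simp
    then obtain s where s: "s \<in> T" "\<bar>t / c - s\<bar> < h / 2"
      using T(2) unfolding dist_real_def by blast
    obtain g where g: "g \<in> G" "norm (e - g) < h" using G(2)[of e] e by (auto simp: dist_norm)
    have "norm ((t / c - s) *\<^sub>R z) \<le> h / 2 * 2"
      unfolding norm_scaleR using s(2) c h by (intro mult_mono) (auto simp: c_def)
    moreover have "norm g - h \<le> norm (g + s *\<^sub>R z)" using ij(2)[OF g(1) s(1)] by (simp add: z_def)
    moreover have "e + t *\<^sub>R y = (g + s *\<^sub>R z) + ((e - g) + (t / c - s) *\<^sub>R z)"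
      by (simp add: y_def algebra_simps)
    then have "norm (g + s *\<^sub>R z) - norm ((e - g) + (t / c - s) *\<^sub>R z) \<le> norm (e + t *\<^sub>R y)"
      using norm_diff_ineq by metis
    moreover have "norm ((e - g) + (t / c - s) *\<^sub>R z) \<le> norm (e - g) + norm ((t / c - s) *\<^sub>R z)"
      by (rule norm_triangle_ineq)
    moreover have "1 - norm (e - g) \<le> norm g"
      using norm_triangle_ineq2[of e "e - g"] e by simp
    ultimately show ?thesis using g(2) h(2) by linarith
  next
    case False
    then show ?thesis
      using norm_diff_ineq[of "t *\<^sub>R y" e] y e d by (simp add: add.commute)
  qed
  have "(1 - d) * norm e \<le> norm (e + t *\<^sub>R y)" if e: "e \<in> span B" for e t
  proof (cases "e = 0")
    case False
    then have "1 - d \<le> norm ((1 / norm e) *\<^sub>R e + (t / norm e) *\<^sub>R y)"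
      using e by (intro unit span_mul) auto
    then have "norm e * (1 - d) \<le> norm e * norm ((1 / norm e) *\<^sub>R e + (t / norm e) *\<^sub>R y)"
      by (rule mult_left_mono) simp
    also have "\<dots> = norm (norm e *\<^sub>R ((1 / norm e) *\<^sub>R e + (t / norm e) *\<^sub>R y))" by simp
    also have "norm e *\<^sub>R ((1 / norm e) *\<^sub>R e + (t / norm e) *\<^sub>R y) = e + t *\<^sub>R y"
      using False by (simp add: scaleR_add_right)
    finally show ?thesis by (simp add: mult.commute)
  qed simp
  with y show ?thesis by blast
qed

text \<open>Reduces bounds against a whole tail to finite ranges, where induction on the right end
  applies.\<close>

lemma span_from_finite:
  assumes "b \<in> span (x ` {n::nat..})"
  shows "\<exists>N\<ge>n. b \<in> span (x ` {n..<N})"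
  using assms
proof (induction rule: span_induct_alt)
  case base
  then show ?case using span_zero by blast
next
  case (step c z b)
  then obtain N m where N: "N \<ge> n" "b \<in> span (x ` {n..<N})" and m: "m \<ge> n" "z = x m" by auto
  have "span (x ` {n..<N}) \<subseteq> span (x ` {n..<max N (Suc m)})"
    by (intro span_mono image_mono) auto
  then have "c *\<^sub>R z + b \<in> span (x ` {n..<max N (Suc m)})"
    using N m by (intro span_add span_mul) (auto intro: span_base)
  then show ?case using N by (intro exI[of _ "max N (Suc m)"]) auto
qed

text \<open>Mazur's construction: each vector is almost orthogonal to the span of its predecessors,
  with losses \<open>(1/2) ^ Suc n\<close> whose tails tend to 0.\<close>

lemma tail_basic_exists:
  assumes inf: "\<not> (\<exists>B :: 'a::real_normed_vector set. finite B \<and> span B = UNIV)"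
  shows "\<exists>x :: nat \<Rightarrow> 'a. tail_basic x \<and> (\<forall>n. norm (x n) = 1)"
proof -
  have "\<exists>x :: nat \<Rightarrow> 'a. \<forall>n. norm (x n) = 1 \<and>
      (\<forall>e\<in>span (x ` {..<n}). \<forall>t. (1 - (1/2) ^ Suc n) * norm e \<le> norm (e + t *\<^sub>R x n))"
  proof (rule dependent_wf_choice[OF wf_less_than])
    fix f g :: "nat \<Rightarrow> 'a" and n r assume "\<And>z. (z, n) \<in> less_than \<Longrightarrow> f z = g z"
    then have "f ` {..<n} = g ` {..<n}" by auto
    then show "(norm r = 1 \<and> (\<forall>e\<in>span (f ` {..<n}). \<forall>t. (1 - (1/2) ^ Suc n) * norm e \<le> norm (e + t *\<^sub>R r))) =
        (norm r = 1 \<and> (\<forall>e\<in>span (g ` {..<n}). \<forall>t. (1 - (1/2) ^ Suc n) * norm e \<le> norm (e + t *\<^sub>R r)))"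
      by simp
  qed (rule almost_orthogonal_vector[OF inf], auto)
  then obtain x :: "nat \<Rightarrow> 'a" where x: "\<And>n. norm (x n) = 1"
    "\<And>n e t. e \<in> span (x ` {..<n}) \<Longrightarrow> (1 - (1/2) ^ Suc n) * norm e \<le> norm (e + t *\<^sub>R x n)" by blast
  \<comment> \<open>The summand \<open>(1/2) ^ N\<close> makes the bound inductive: with
    \<open>h = (1/2) ^ Suc N\<close> one has \<open>q + h \<le> (1 - h) * (q + 2 * h)\<close> as
    long as \<open>q + 2 * h \<le> 1\<close>.\<close>
  have proj: "(1 - (1/2) ^ n + (1/2) ^ N) * norm a \<le> norm (a + b)"
    if "n \<le> N" "a \<in> span (x ` {..<n})" "b \<in> span (x ` {n..<N})" for n N a b
    using that
  proof (induction N arbitrary: b rule: dec_induct)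
    case base
    then show ?case by simp
  next
    case (step N)
    have "{n..<Suc N} = insert N {n..<N}" using step.hyps by auto
    then obtain t where t: "b - t *\<^sub>R x N \<in> span (x ` {n..<N})"
      using step.prems(2) by (auto simp: span_insert)
    define h q where "h = (1/2::real) ^ Suc N" and "q = 1 - (1/2::real) ^ n"
    have "(1/2::real) ^ N \<le> (1/2) ^ n" using step.hyps(1) by (rule power_decreasing) simp_all
    moreover have "(1/2::real) ^ N \<le> 1" by (simp add: power_le_one)
    ultimately have h: "0 \<le> h" "h \<le> 1" "q + 2 * h \<le> 1" by (auto simp: h_def q_def)
    have IH: "(q + 2 * h) * norm a \<le> norm (a + (b - t *\<^sub>R x N))"
      using step.IH[OF step.prems(1) t] by (simp add: h_def q_def)
    have "h * (q + 2 * h) \<le> h * 1" using h by (intro mult_left_mono) auto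
    then have "q + h \<le> (1 - h) * (q + 2 * h)" by (simp add: algebra_simps)
    then have "(q + h) * norm a \<le> (1 - h) * ((q + 2 * h) * norm a)"
      by (metis mult.assoc mult_right_mono norm_ge_zero)
    also have "\<dots> \<le> (1 - h) * norm (a + (b - t *\<^sub>R x N))"
      using IH h by (intro mult_left_mono) auto
    also have "\<dots> \<le> norm ((a + (b - t *\<^sub>R x N)) + t *\<^sub>R x N)"
    proof -
      have "span (x ` {..<n}) \<subseteq> span (x ` {..<N})" "span (x ` {n..<N}) \<subseteq> span (x ` {..<N})"
        using step.hyps by (intro span_mono image_mono; auto)+
      then have "a + (b - t *\<^sub>R x N) \<in> span (x ` {..<N})"
        using t step.prems(1) by (intro span_add) auto
      then show ?thesis unfolding h_def by (rule x(2))
    qed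
    finally show ?case by (simp add: h_def q_def)
  qed
  have "tail_basic x"
    unfolding tail_basic_def
  proof (intro allI impI)
    fix d :: real assume d: "0 < d"
    then obtain n0 where n0: "(1/2) ^ n0 < d / (1 + d)"
      using real_arch_pow_inv[of "d / (1 + d)" "1/2"] by (auto simp: field_simps)
    have "norm a \<le> (1 + d) * norm (a + b)"
      if n: "n \<ge> n0" and a: "a \<in> span (x ` {..<n})" and b: "b \<in> span (x ` {n..})" for n a b
    proof -
      obtain N where N: "N \<ge> n" "b \<in> span (x ` {n..<N})" using span_from_finite[OF b] by blast
      have "(1/2::real) ^ n \<le> (1/2) ^ n0" using n by (rule power_decreasing) simp_all
      moreover have "1 / (1 + d) = 1 - d / (1 + d)" using d by (simp add: field_simps)
      ultimately have "1 / (1 + d) \<le> 1 - (1/2) ^ n + (1/2) ^ N"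
        using n0 zero_le_power[of "1/2::real" N] by linarith
      then have "1 / (1 + d) * norm a \<le> norm (a + b)"
        using proj[OF N(1) a N(2)] by (meson mult_right_mono norm_ge_zero order_trans)
      then show ?thesis using d by (simp add: field_simps)
    qed
    then show "\<exists>n0. \<forall>n\<ge>n0. \<forall>a\<in>span (x ` {..<n}). \<forall>b\<in>span (x ` {n..}). norm a \<le> (1 + d) * norm (a + b)"
      by blast
  qed
  with x show ?thesis by blast
qed

section \<open>Free ultrafilters and acceptance of finite sets\<close>

locale free_ultrafilter =
  fixes U :: "nat filter"
  assumes nontrivial: "U \<noteq> bot"
    and free: "U \<le> sequentially"
    and ultra: "eventually P U \<or> eventually (\<lambda>n. \<not> P n) U"

text \<open>Zorn's lemma gives a minimal proper filter below \<open>sequentially\<close>; the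
  infimum of a chain of proper filters is proper. If \<open>P\<close> does not fail eventually,
  restricting to \<open>P\<close> gives a proper filter, which by minimality is \<open>U\<close>
  itself.\<close>

lemma free_ultrafilter_exists: "\<exists>U. free_ultrafilter U"
proof -
  define A where "A = {F :: nat filter. F \<noteq> bot \<and> F \<le> sequentially}"
  define below where "below F G \<longleftrightarrow> G \<le> F" for F G :: "nat filter"
  have "\<exists>M\<in>A. \<forall>G\<in>A. below M G \<longrightarrow> G = M"
  proof (rule predicate_Zorn)
    show "partial_order_on A (relation_of below A)"
      by (rule partial_order_on_relation_ofI) (auto simp: below_def)
    fix C assume C: "C \<in> Chains (relation_of below A)"
    show "\<exists>u\<in>A. \<forall>a\<in>C. below a u"
    proof (cases "C = {}")
      case True
      then show ?thesis by (auto simp: A_def intro!: exI[of _ sequentially])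
    next
      case False
      have CA: "C \<subseteq> A" using C by (auto simp: Chains_def relation_of_def)
      have "eventually (\<lambda>_. False) (Inf C) \<longleftrightarrow> (\<exists>b\<in>C. eventually (\<lambda>_. False) b)"
      proof (rule eventually_Inf_base[OF False])
        fix F G assume "F \<in> C" "G \<in> C"
        then have "F \<le> G \<or> G \<le> F" using C by (auto simp: Chains_def relation_of_def below_def)
        then show "\<exists>x\<in>C. x \<le> inf F G"
          using \<open>F \<in> C\<close> \<open>G \<in> C\<close> by (auto intro: bexI[of _ F] bexI[of _ G])
      qed
      then have "Inf C \<noteq> bot" using CA by (auto simp: A_def trivial_limit_def)
      moreover have "Inf C \<le> sequentially"
        using False CA by (auto simp: A_def intro: Inf_lower2)
      ultimately show ?thesis
        by (intro bexI[of _ "Inf C"]) (auto simp: A_def below_def intro: Inf_lower)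
    qed
  qed
  then obtain U where U: "U \<noteq> bot" "U \<le> sequentially"
    and max: "\<And>G. G \<noteq> bot \<Longrightarrow> G \<le> U \<Longrightarrow> G = U"
    by (auto simp: A_def below_def intro: order_trans)
  have "eventually P U \<or> eventually (\<lambda>n. \<not> P n) U" for P
  proof (rule disjCI)
    assume "\<not> eventually (\<lambda>n. \<not> P n) U"
    then have "inf U (principal {n. P n}) \<noteq> bot"
      by (simp add: trivial_limit_def eventually_inf_principal)
    then have "inf U (principal {n. P n}) = U" by (rule max) simp
    moreover have "eventually P (inf U (principal {n. P n}))"
      by (simp add: eventually_inf_principal)
    ultimately show "eventually P U" by simp
  qed
  with U have "free_ultrafilter U" by unfold_locales
  then show ?thesis ..
qed

context free_ultrafilter
begin

lemma eventually_gt: "eventually (\<lambda>n. m < n) U"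
  by (rule filter_leD[OF free]) (rule eventually_gt_at_top)

lemma eventually_above: "finite s \<Longrightarrow> eventually (\<lambda>n. \<forall>i\<in>s. i < n) U"
  by (intro eventually_ball_finite) (auto intro: eventually_gt)

lemma eventually_ex: "eventually P U \<Longrightarrow> \<exists>n. P n"
  using nontrivial eventually_happens by blast

text \<open>An ultrafilter version of \<open>every infinite set has an initial segment in F\<close>; it replaces
  the Nash-Williams partition theorem.\<close>

inductive accepts :: "nat set set \<Rightarrow> nat set \<Rightarrow> bool" for F where
  mem: "s \<in> F \<Longrightarrow> accepts F s"
| step: "eventually E U \<Longrightarrow> (\<And>n. E n \<Longrightarrow> accepts F (insert n s)) \<Longrightarrow> accepts F s"

lemma accepts_stepI: "eventually (\<lambda>n. accepts F (insert n s)) U \<Longrightarrow> accepts F s"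
  by (rule accepts.step)

lemma accepts_cases: "accepts F s \<Longrightarrow> s \<in> F \<or> eventually (\<lambda>n. accepts F (insert n s)) U"
  by (erule accepts.cases) (blast intro: eventually_mono)+

text \<open>The ultrafilter property makes rejection, like acceptance, pass to most one-point
  extensions.\<close>

lemma not_accepts: "\<not> accepts F s \<Longrightarrow> eventually (\<lambda>n. \<not> accepts F (insert n s)) U"
  using ultra accepts_stepI by blast

lemma accepts_mono: "accepts F s \<Longrightarrow> F \<subseteq> G \<Longrightarrow> accepts G s"
  by (induction rule: accepts.induct) (auto intro: accepts.intros)

text \<open>If each of the finitely many families rejected \<open>s\<close>, then for most
  \<open>n\<close> all of them would reject \<open>insert n s\<close>, against the induction
  hypothesis.\<close>

lemma accepts_Union:
  assumes "accepts (\<Union>i\<in>I. F i) s" "finite I"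
  shows "\<exists>i\<in>I. accepts (F i) s"
  using assms(1)
proof induction
  case (mem s)
  then show ?case by (auto intro: accepts.mem)
next
  case (step E s)
  show ?case
  proof (rule ccontr)
    assume "\<not> ?case"
    then have "\<forall>i\<in>I. eventually (\<lambda>n. \<not> accepts (F i) (insert n s)) U"
      using not_accepts by blast
    then have "eventually (\<lambda>n. \<forall>i\<in>I. \<not> accepts (F i) (insert n s)) U"
      by (rule eventually_ball_finite[OF \<open>finite I\<close>])
    with step.hyps(1) have "eventually (\<lambda>n. False) U"
      by eventually_elim (use step.IH in blast)
    then show False using eventually_ex by blast
  qed
qed

text \<open>Follows the well-founded tree of acceptance, at each node taking an \<open>n\<close>
  that also preserves \<open>Q\<close>.\<close>

lemma accepts_hit:
  assumes "accepts F s" "finite s" "Q s"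
    and "\<And>s. finite s \<Longrightarrow> Q s \<Longrightarrow> eventually (\<lambda>n. Q (insert n s)) U"
  shows "\<exists>B\<in>F. finite B \<and> s \<subseteq> B \<and> Q B"
  using assms(1-3)
proof induction
  case (mem s)
  then show ?case by blast
next
  case (step E s)
  have "eventually (\<lambda>n. E n \<and> Q (insert n s)) U"
    using step assms(4) by (intro eventually_conj) auto
  then obtain n where "E n" "Q (insert n s)" using eventually_ex by blast
  with step.IH[of n] step.prems show ?case by auto
qed

lemma eventually_initial_segment:
  assumes "finite s" "\<exists>k. s \<inter> {..<k} \<in> F"
  shows "eventually (\<lambda>n. \<exists>k. insert n s \<inter> {..<k} \<in> F) U"
proof -
  obtain k where k: "s \<inter> {..<k} \<in> F" using assms by blast
  show ?thesis
    using eventually_gt[of k]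
  proof eventually_elim
    case (elim n)
    then have "insert n s \<inter> {..<k} = s \<inter> {..<k}" by auto
    with k show ?case by metis
  qed
qed

text \<open>The families are met one after another. A cut that has met one of them stays valid,
  since most new elements lie above it; \<open>G\<close> holds finally because the set ends in some
  family or is the initial \<open>s\<close>.\<close>

lemma accepts_hit_all:
  assumes "finite J" "\<And>j. j \<in> J \<Longrightarrow> accepts (F j) s"
    and "\<And>j B. j \<in> J \<Longrightarrow> B \<in> F j \<Longrightarrow> G B" and "finite s" "G s" "Q s"
    and "\<And>s. finite s \<Longrightarrow> Q s \<Longrightarrow> eventually (\<lambda>n. Q (insert n s)) U"
  shows "\<exists>B. finite B \<and> s \<subseteq> B \<and> G B \<and> Q B \<and> (\<forall>j\<in>J. \<exists>k. B \<inter> {..<k} \<in> F j)"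
  using assms
proof (induction J arbitrary: Q rule: finite_induct)
  case empty
  then show ?case by blast
next
  case (insert j J)
  define hit where "hit j B \<longleftrightarrow> (\<exists>k. B \<inter> {..<k} \<in> F j)" for j B
  have hit_step: "eventually (\<lambda>n. hit j (insert n s)) U" if "finite s" "hit j s" for j s
    using eventually_initial_segment that unfolding hit_def by blast
  \<comment> \<open>The induction hypothesis is used with a stronger \<open>Q\<close>, so that
    meeting the other families never loses acceptance by \<open>F j\<close> unless
    \<open>F j\<close> has been met.\<close>
  have "\<exists>B. finite B \<and> s \<subseteq> B \<and> G B \<and> (Q B \<and> (accepts (F j) B \<or> hit j B)) \<and>
      (\<forall>j\<in>J. \<exists>k. B \<inter> {..<k} \<in> F j)"
  proof (rule insert.IH)
    fix s' assume s': "finite s'" "Q s' \<and> (accepts (F j) s' \<or> hit j s')"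
    then have "accepts (F j) s' \<Longrightarrow> hit j s' \<or> eventually (\<lambda>n. accepts (F j) (insert n s')) U"
      using accepts_cases[of "F j" s'] finite_nat_iff_bounded[of s'] unfolding hit_def
      by (metis Int_absorb2)
    then have "eventually (\<lambda>n. accepts (F j) (insert n s') \<or> hit j (insert n s')) U"
      using s' hit_step[of s' j] by (metis (mono_tags, lifting) eventually_mono)
    with insert.prems(6)[of s'] s'
    show "eventually (\<lambda>n. Q (insert n s') \<and> (accepts (F j) (insert n s') \<or> hit j (insert n s'))) U"
      by (auto intro: eventually_conj)
  qed (use insert.prems in auto)
  then obtain B where B: "finite B" "s \<subseteq> B" "G B" "Q B" "accepts (F j) B \<or> hit j B"
    "\<And>i. i \<in> J \<Longrightarrow> hit i B" unfolding hit_def by blast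
  show ?case
  proof (cases "hit j B")
    case True
    with B show ?thesis unfolding hit_def by blast
  next
    case False
    with B have "accepts (F j) B" by blast
    then have "\<exists>B'\<in>F j. finite B' \<and> B \<subseteq> B' \<and> (Q B' \<and> (\<forall>i\<in>J. hit i B'))"
    proof (rule accepts_hit)
      fix s' assume s': "finite s'" "Q s' \<and> (\<forall>i\<in>J. hit i s')"
      then have "eventually (\<lambda>n. \<forall>i\<in>J. hit i (insert n s')) U"
        using insert.hyps(1) hit_step by (intro eventually_ball_finite) auto
      with insert.prems(6)[of s'] s' show "eventually (\<lambda>n. Q (insert n s') \<and> (\<forall>i\<in>J. hit i (insert n s'))) U"
        by (auto intro: eventually_conj)
    qed (use B in auto)
    then obtain B' where B': "B' \<in> F j" "finite B'" "B \<subseteq> B'" "Q B'" "\<forall>i\<in>J. hit i B'" by blast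
    then have "hit j B'"
      using finite_nat_iff_bounded[of B'] unfolding hit_def by (metis Int_absorb2)
    moreover have "G B'" using B' insert.prems(2) by blast
    ultimately show ?thesis using B' B(2) unfolding hit_def by blast
  qed
qed

end

section \<open>Alternating sums over finite sets\<close>

text \<open>Counting the elements below \<open>i\<close> avoids enumerating \<open>A\<close> and
  shows that a sign depends only on smaller elements.\<close>

definition alternating_sum :: "(nat \<Rightarrow> 'a::real_normed_vector) \<Rightarrow> nat set \<Rightarrow> 'a" where
  "alternating_sum x A = (\<Sum>i\<in>A. (-1) ^ card (A \<inter> {..<i}) *\<^sub>R x i)"

lemma alternating_sum_empty [simp]: "alternating_sum x {} = 0"
  by (simp add: alternating_sum_def)

lemma alternating_sum_singleton [simp]: "alternating_sum x {n} = x n"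
  by (simp add: alternating_sum_def)

lemma alternating_sum_insert_less:
  assumes "finite A" "\<And>i. i \<in> A \<Longrightarrow> n < i"
  shows "alternating_sum x (insert n A) = x n - alternating_sum x A"
proof -
  have n: "n \<notin> A" using assms(2) by blast
  have "insert n A \<inter> {..<i} = insert n (A \<inter> {..<i})" if "i \<in> A" for i
    using assms(2)[OF that] by auto
  then have "card (insert n A \<inter> {..<i}) = Suc (card (A \<inter> {..<i}))" if "i \<in> A" for i
    using that n assms(1) by simp
  moreover have "insert n A \<inter> {..<n} = {}" using assms(2) by (auto dest: less_asym)
  ultimately show ?thesis
    using n assms(1) by (simp add: alternating_sum_def sum_negf)
qed

lemma alternating_sum_in_span: "alternating_sum x A \<in> span (x ` A)"
  unfolding alternating_sum_def by (intro span_sum span_mul span_base) auto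

text \<open>Signs on an initial segment agree with those in the whole set, so only terms from
  \<open>k\<close> on remain.\<close>

lemma alternating_sum_diff_in_span:
  assumes "finite A"
  shows "alternating_sum x A - alternating_sum x (A \<inter> {..<k}) \<in> span (x ` (A \<inter> {k..}))"
proof -
  have "alternating_sum x A =
      (\<Sum>i\<in>A \<inter> {..<k}. (-1) ^ card (A \<inter> {..<i}) *\<^sub>R x i) + (\<Sum>i\<in>A \<inter> {k..}. (-1) ^ card (A \<inter> {..<i}) *\<^sub>R x i)"
    unfolding alternating_sum_def using assms
    by (subst sum.union_disjoint[symmetric]) (auto intro!: sum.cong)
  also have "(\<Sum>i\<in>A \<inter> {..<k}. (-1) ^ card (A \<inter> {..<i}) *\<^sub>R x i) = alternating_sum x (A \<inter> {..<k})"
    unfolding alternating_sum_def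
  proof (rule sum.cong)
    fix i assume "i \<in> A \<inter> {..<k}"
    then have "A \<inter> {..<k} \<inter> {..<i} = A \<inter> {..<i}" by auto
    then show "(-1) ^ card (A \<inter> {..<i}) *\<^sub>R x i = (-1) ^ card (A \<inter> {..<k} \<inter> {..<i}) *\<^sub>R x i"
      by simp
  qed simp
  finally show ?thesis by (simp, intro span_sum span_mul span_base) auto
qed

lemma alternating_sum_image:
  assumes f: "strict_mono f"
  shows "alternating_sum x (f ` A) = alternating_sum (x \<circ> f) A"
proof -
  have inj: "inj f" using f by (rule strict_mono_imp_inj_on)
  have "f ` A \<inter> {..<f i} = f ` (A \<inter> {..<i})" for i
    using f by (auto simp: strict_mono_less)
  then have "card (f ` A \<inter> {..<f i}) = card (A \<inter> {..<i})" for i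
    using inj by (simp add: card_image inj_on_subset)
  then show ?thesis
    unfolding alternating_sum_def using inj by (subst sum.reindex) (auto intro: inj_on_subset)
qed

lemma alternating_sum_lessThan:
  "alternating_sum x {..<k} = (\<Sum>i<k. (-1) ^ i *\<^sub>R x i)"
proof -
  have "{..<k} \<inter> {..<i} = {..<i}" if "i < k" for i using that by auto
  then show ?thesis unfolding alternating_sum_def by (intro sum.cong) auto
qed

section \<open>The accepting and the rejecting case\<close>

text \<open>For \<open>u = x n\<close> and \<open>A\<close> above \<open>n\<close>, the last vector
  is the alternating sum of \<open>insert n A\<close>: prepending \<open>n\<close> lifts the norm
  from at most \<open>c\<close> to at least \<open>g\<close>.\<close>

definition far_sets :: "(nat \<Rightarrow> 'a::real_normed_vector) \<Rightarrow> real \<Rightarrow> 'a \<Rightarrow> real \<Rightarrow> nat set set" where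
  "far_sets x c u g = {A. finite A \<and> norm (alternating_sum x A) \<le> c \<and> g \<le> norm (u - alternating_sum x A)}"

context free_ultrafilter
begin

text \<open>The candidates for \<open>B\<close> share their least element \<open>n\<close>; as averages of the remaining parts are
  small, one of the candidates inherits from \<open>x\<^sub>n\<close> the property of being far from later blocks.\<close>

lemma accepting_set:
  fixes x :: "nat \<Rightarrow> 'a::real_normed_vector"
  assumes x: "tail_basic x" "\<And>n. norm (x n) = 1" and nonsep: "\<not> symmetrically_separable TYPE('a)"
    and c: "1 \<le> c'" "c' < g" "g < c"
    and acc: "eventually (\<lambda>n. accepts (far_sets x c' (x n) c) {}) U"
    and S: "finite S" "\<And>u. u \<in> S \<Longrightarrow> norm u \<le> c'" "\<And>u. u \<in> S \<Longrightarrow> accepts (far_sets x c' u g) {}"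
  shows "\<exists>B. finite B \<and> B \<noteq> {} \<and> B \<subseteq> {t..} \<and> norm (alternating_sum x B) \<le> c' \<and>
    accepts (far_sets x c' (alternating_sum x B) g) {} \<and>
    (\<forall>u\<in>S. \<exists>k. g \<le> norm (u - alternating_sum x (B \<inter> {..<k})))"
proof -
  \<comment> \<open>The empty set is not in the family, as \<open>norm u \<le> c' < g\<close>; so
    acceptance of it passes to most singletons.\<close>
  have "eventually (\<lambda>n. accepts (far_sets x c' u g) {n}) U" if "u \<in> S" for u
    using accepts_cases[OF S(3)[OF that]] S(2)[OF that] c by (auto simp: far_sets_def)
  then have "eventually (\<lambda>n. \<forall>u\<in>S. accepts (far_sets x c' u g) {n}) U"
    by (intro eventually_ball_finite[OF S(1)]) auto
  then have "eventually (\<lambda>n. t < n \<and> accepts (far_sets x c' (x n) c) {} \<and>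
      (\<forall>u\<in>S. accepts (far_sets x c' u g) {n})) U"
    by (intro eventually_conj eventually_gt acc)
  then obtain n where n: "t < n" "accepts (far_sets x c' (x n) c) {}"
      "\<And>u. u \<in> S \<Longrightarrow> accepts (far_sets x c' u g) {n}"
    using eventually_ex by blast
  \<comment> \<open>Candidates with the common least element \<open>n\<close> and all other elements
    arbitrarily far out, so that these remainders can be made successive blocks.\<close>
  have "\<exists>B. finite B \<and> {n} \<subseteq> B \<and> norm (alternating_sum x B) \<le> c' \<and>
      B \<subseteq> insert n {max r (Suc n)..} \<and> (\<forall>u\<in>S. \<exists>k. B \<inter> {..<k} \<in> far_sets x c' u g)" for r
  proof (rule accepts_hit_all[OF S(1)])
    fix s assume "finite s" "s \<subseteq> insert n {max r (Suc n)..}"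
    then show "eventually (\<lambda>m. insert m s \<subseteq> insert n {max r (Suc n)..}) U"
      using eventually_gt[of "max r (Suc n)"] by (auto elim!: eventually_mono)
  qed (use n c x(2) in \<open>auto simp: far_sets_def\<close>)
  then obtain B where "\<And>r. finite (B r) \<and> {n} \<subseteq> B r \<and> norm (alternating_sum x (B r)) \<le> c' \<and>
      B r \<subseteq> insert n {max r (Suc n)..} \<and> (\<forall>u\<in>S. \<exists>k. B r \<inter> {..<k} \<in> far_sets x c' u g)"
    by metis
  then have B: "\<And>r. finite (B r)" "\<And>r. n \<in> B r" "\<And>r. norm (alternating_sum x (B r)) \<le> c'"
      "\<And>r. B r \<subseteq> insert n {max r (Suc n)..}"
      "\<And>r u. u \<in> S \<Longrightarrow> \<exists>k. B r \<inter> {..<k} \<in> far_sets x c' u g"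
    by simp_all
  define A where "A r = B r - {n}" for r
  have A: "finite (A r)" "A r \<subseteq> {r..}" "\<And>i. i \<in> A r \<Longrightarrow> n < i" "B r = insert n (A r)" for r
    using B(1,2)[of r] B(4)[of r] by (auto simp: A_def)
  define G where "G r = Suc (Max (insert r (A r)))" for r
  have "r < G r" for r using A(1) by (simp add: G_def less_Suc_eq_le)
  then obtain T where T: "T 0 = Suc n" "strict_mono T" "\<And>l. T (Suc l) = G (T l)"
    by (rule iterate_strict_mono) (rule that)
  have AG: "A r \<subseteq> {r..<G r}" for r
    using A(1,2)[of r] by (auto simp: G_def less_Suc_eq_le intro!: Max_ge)
  define w where "w l = - alternating_sum x (A (T l))" for l
  have Bw: "alternating_sum x (B (T l)) = x n + w l" for l
    using A by (simp add: w_def alternating_sum_insert_less)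
  have "tail_basic w"
  proof (rule tail_basic_block[OF x(1) T(2)])
    fix l
    have "span (x ` A (T l)) \<subseteq> span (x ` {T l..<T (Suc l)})"
      using AG[of "T l"] T(3) by (intro span_mono image_mono) auto
    then show "w l \<in> span (x ` {T l..<T (Suc l)})"
      unfolding w_def using alternating_sum_in_span by (intro span_neg) blast
  qed
  moreover have "norm (w l) \<le> c' + 1" for l
    using norm_triangle_ineq4[of "x n + w l" "x n"] B(3)[of "T l"] x(2)[of n] by (simp add: Bw)
  ultimately obtain K where K: "finite K" "K \<noteq> {}" "norm (sum w K) \<le> (c - g) * card K"
    using small_average[of w "c' + 1" "c - g"] nonsep c by auto
  \<comment> \<open>Averaging: if \<open>norm y\<close> is at least \<open>c\<close> and the average
    of the \<open>w l\<close> has norm at most \<open>c - g\<close>, the vectors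
    \<open>y + w l\<close> cannot all have norm below \<open>g\<close>. Acceptance then passes to
    one \<open>l\<close>.\<close>
  have "far_sets x c' (x n) c \<subseteq> (\<Union>l\<in>K. far_sets x c' (x n + w l) g)"
  proof
    fix C assume C: "C \<in> far_sets x c' (x n) c"
    define y where "y = x n - alternating_sum x C"
    have "\<exists>l\<in>K. g \<le> norm (y + w l)"
    proof (rule ccontr)
      assume "\<not> ?thesis"
      then have "(\<Sum>l\<in>K. norm (y + w l)) < (\<Sum>l\<in>K. g)"
        using K by (intro sum_strict_mono) auto
      then have "norm (\<Sum>l\<in>K. y + w l) < card K * g"
        using norm_sum[of "\<lambda>l. y + w l" K] by simp
      moreover have "(\<Sum>l\<in>K. y + w l) = card K *\<^sub>R y + sum w K"
        by (simp add: sum.distrib sum_constant_scaleR)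
      ultimately have "card K * norm y - norm (sum w K) < card K * g"
        using norm_diff_ineq[of "card K *\<^sub>R y" "sum w K"] by simp
      moreover have "card K * c \<le> card K * norm y"
        using C by (intro mult_left_mono) (auto simp: far_sets_def y_def)
      ultimately show False using K(3) by (simp add: algebra_simps)
    qed
    then show "C \<in> (\<Union>l\<in>K. far_sets x c' (x n + w l) g)"
      using C by (auto simp: far_sets_def y_def algebra_simps)
  qed
  then obtain l where "accepts (far_sets x c' (x n + w l) g) {}"
    using accepts_Union[OF accepts_mono[OF n(2)] K(1)] by blast
  moreover have "\<exists>k. g \<le> norm (u - alternating_sum x (B (T l) \<inter> {..<k}))" if "u \<in> S" for u
    using B(5)[OF that, of "T l"] by (auto simp: far_sets_def)
  moreover have "B (T l) \<subseteq> {t..}" using B(4)[of "T l"] n(1) by auto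
  ultimately show ?thesis
    using B(1,2,3)[of "T l"] Bw[of l] by (intro exI[of _ "B (T l)"]) auto
qed

text \<open>Each new block has a cut that is far from all earlier blocks and is itself accepting, so
  the choice can continue.\<close>

lemma accepting_imp_separable:
  fixes x :: "nat \<Rightarrow> 'a::real_normed_vector"
  assumes x: "tail_basic x" "\<And>n. norm (x n) = 1"
    and c: "1 \<le> c'" "c' < c"
    and acc: "eventually (\<lambda>n. accepts (far_sets x c' (x n) c) {}) U"
  shows "symmetrically_separable TYPE('a)"
proof (rule ccontr)
  assume nonsep: "\<not> symmetrically_separable TYPE('a)"
  \<comment> \<open>The gap above \<open>g\<close> is spent on the averaging in
    \<open>accepting_set\<close>, the gap below it on the basis constant.\<close>
  define g where "g = (c' + c) / 2"
  have g: "c' < g" "g < c" using c by (auto simp: g_def)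
  define d where "d = (g - c') / (2 * c')"
  have d: "0 < d" "(1 + d) * c' < g" using c g by (auto simp: d_def field_simps)
  obtain n0 where n0: "\<And>n a b. n \<ge> n0 \<Longrightarrow> a \<in> span (x ` {..<n}) \<Longrightarrow> b \<in> span (x ` {n..}) \<Longrightarrow>
    norm a \<le> (1 + d) * norm (a + b)"
    using tail_basicE[OF x(1) d(1)] by metis
  \<comment> \<open>All eligible vectors supported below \<open>t\<close> are treated at once; thus
    \<open>B\<close> depends on \<open>t\<close> only and no history of the recursion is
    needed.\<close>
  define S where "S t = {u \<in> alternating_sum x ` Pow {..<t}. norm u \<le> c' \<and> accepts (far_sets x c' u g) {}}" for t
  have "\<exists>B. finite B \<and> B \<noteq> {} \<and> B \<subseteq> {t..} \<and> norm (alternating_sum x B) \<le> c' \<and>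
    accepts (far_sets x c' (alternating_sum x B) g) {} \<and>
    (\<forall>u\<in>S t. \<exists>k. g \<le> norm (u - alternating_sum x (B \<inter> {..<k})))" for t
    by (rule accepting_set[OF x nonsep c(1) g acc]) (auto simp: S_def)
  then obtain B where "\<And>t. finite (B t) \<and> B t \<noteq> {} \<and> B t \<subseteq> {t..} \<and> norm (alternating_sum x (B t)) \<le> c' \<and>
    accepts (far_sets x c' (alternating_sum x (B t)) g) {} \<and>
    (\<forall>u\<in>S t. \<exists>k. g \<le> norm (u - alternating_sum x (B t \<inter> {..<k})))"
    by metis
  then have B: "\<And>t. finite (B t)" "\<And>t. B t \<noteq> {}" "\<And>t. B t \<subseteq> {t..}"
    "\<And>t. norm (alternating_sum x (B t)) \<le> c'" "\<And>t. accepts (far_sets x c' (alternating_sum x (B t)) g) {}"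
    "\<And>t u. u \<in> S t \<Longrightarrow> \<exists>k. g \<le> norm (u - alternating_sum x (B t \<inter> {..<k}))"
    by simp_all
  define G where "G t = Suc (Max (B t))" for t
  have BG: "B t \<subseteq> {t..<G t}" for t
    using B(1,3)[of t] by (auto simp: G_def less_Suc_eq_le)
  then have "t < G t" for t using B(2)[of t] by fastforce
  then obtain T where T: "T 0 = n0" "strict_mono T" "\<And>k. T (Suc k) = G (T k)"
    by (rule iterate_strict_mono) (rule that)
  define v where "v k = alternating_sum x (B (T k))" for k
  define u where "u k = (1 / c') *\<^sub>R v k" for k
  have "tail_basic u"
  proof (rule tail_basic_block[OF x(1) T(2)])
    fix k
    have "span (x ` B (T k)) \<subseteq> span (x ` {T k..<T (Suc k)})"
      using BG[of "T k"] T(3) by (intro span_mono image_mono) auto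
    then show "u k \<in> span (x ` {T k..<T (Suc k)})"
      unfolding u_def v_def using alternating_sum_in_span by (intro span_mul) blast
  qed
  moreover have "norm (u k) \<le> 1" for k using B(4)[of "T k"] c by (simp add: u_def v_def)
  moreover define e where "e = g / ((1 + d) * c') - 1"
  moreover have pos: "0 < (1 + d) * c'" using c d by simp
  moreover have "0 < e" using d pos by (simp add: e_def less_divide_eq)
  moreover have "1 + e \<le> norm (u j - u k)" if "j < k" for j k
  proof -
    have "T (Suc j) \<le> T k" using that T(2) by (simp add: strict_mono_less_eq Suc_leI)
    then have Bj: "B (T j) \<subseteq> {..<T k}" using BG[of "T j"] T(3) by auto
    then have "v j \<in> S (T k)" using B(4,5) by (auto simp: S_def v_def)
    then obtain m where m: "g \<le> norm (v j - alternating_sum x (B (T k) \<inter> {..<m}))"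
      using B(6) by blast
    also have "\<dots> \<le> (1 + d) * norm ((v j - alternating_sum x (B (T k) \<inter> {..<m})) +
        - (v k - alternating_sum x (B (T k) \<inter> {..<m})))"
    \<comment> \<open>The cut must also lie beyond \<open>v j\<close>, hence the maximum; elements
      of \<open>B (T k)\<close> are at least \<open>T k\<close>, so those from \<open>m\<close> on
      stay in the tail.\<close>
    proof (rule n0[of "max m (T k)"])
      show "n0 \<le> max m (T k)" using T(1,2) by (metis le0 max.coboundedI2 strict_mono_less_eq)
      have "span (x ` B (T j)) \<subseteq> span (x ` {..<max m (T k)})"
        "span (x ` (B (T k) \<inter> {..<m})) \<subseteq> span (x ` {..<max m (T k)})"
        using Bj by (intro span_mono image_mono; auto)+
      then show "v j - alternating_sum x (B (T k) \<inter> {..<m}) \<in> span (x ` {..<max m (T k)})"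
        unfolding v_def using alternating_sum_in_span by (intro span_diff) blast+
      have "span (x ` (B (T k) \<inter> {m..})) \<subseteq> span (x ` {max m (T k)..})"
        using B(3)[of "T k"] by (intro span_mono image_mono) auto
      then show "- (v k - alternating_sum x (B (T k) \<inter> {..<m})) \<in> span (x ` {max m (T k)..})"
        unfolding v_def using alternating_sum_diff_in_span[OF B(1)] by (intro span_neg) blast
    qed
    also have "\<dots> = (1 + d) * c' * norm (u j - u k)"
      using c by (simp add: u_def scaleR_diff_right[symmetric])
    finally show ?thesis using pos by (simp add: e_def divide_le_eq mult.commute)
  qed
  ultimately show False using nonsep separated_differences by blast
qed

text \<open>The family attached to \<open>f i\<close> is made to reject all finite sets of later
  values. Prepending \<open>f j\<close> then raises the bound from \<open>c (Suc j)\<close> to at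
  most \<open>c j\<close>, and induction from the right never exceeds \<open>c 0\<close>.\<close>

lemma rejecting_subsequence:
  fixes x :: "nat \<Rightarrow> 'a::real_normed_vector" and c :: "nat \<Rightarrow> real"
  assumes c: "decseq c" "\<And>k. 0 \<le> c k" "\<And>n. norm (x n) \<le> c k"
    and rej: "\<And>k. \<not> eventually (\<lambda>n. accepts (far_sets x (c (Suc k)) (x n) (c k)) {}) U"
  shows "\<exists>f. strict_mono f \<and> (\<forall>A. finite A \<longrightarrow> norm (alternating_sum (x \<circ> f) A) \<le> c 0)"
proof -
  define F where "F i n = far_sets x (c (Suc i)) (x n) (c i)" for i n
  \<comment> \<open>Only sets containing the new value \<open>n\<close> need attention: a nonempty
    set of earlier values was handled when its largest element was chosen, and the empty set when
    \<open>f i\<close> was.\<close>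
  define P where "P f k n \<longleftrightarrow> (\<forall>i<k. f i < n) \<and> \<not> accepts (F k n) {} \<and>
    (\<forall>i<k. \<forall>s\<in>Pow (f ` {i<..<k}). \<not> accepts (F i (f i)) (insert n s))" for f k n
  have rejects: "\<not> accepts (F i (f i)) s"
    if f: "\<And>j. j < k \<Longrightarrow> P f j (f j)" and "i < k" and s: "s \<subseteq> f ` {i<..<k}" for f k i s
  proof (cases "s = {}")
    case True
    then show ?thesis using f[OF \<open>i < k\<close>] by (simp add: P_def)
  next
    case False
    define J where "J = {j \<in> {i<..<k}. f j \<in> s}"
    have J: "finite J" "J \<noteq> {}" using False s by (auto simp: J_def)
    define j where "j = Max J"
    have j: "j \<in> J" unfolding j_def using J by (rule Max_in)
    have "s - {f j} \<subseteq> f ` {i<..<j}"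
    proof
      fix m assume m: "m \<in> s - {f j}"
      then obtain l where l: "l \<in> {i<..<k}" "m = f l" using s by blast
      then have "l \<in> J" using m by (auto simp: J_def)
      then have "l \<le> j" using J by (simp add: j_def)
      moreover have "l \<noteq> j" using l m by auto
      ultimately show "m \<in> f ` {i<..<j}" using l by auto
    qed
    moreover have "i < j" "j < k" "f j \<in> s" using j by (auto simp: J_def)
    ultimately have "\<not> accepts (F i (f i)) (insert (f j) (s - {f j}))"
      using f[of j] unfolding P_def by blast
    then show ?thesis using \<open>f j \<in> s\<close> by (simp add: insert_absorb)
  qed
  have "\<exists>f. \<forall>k. P f k (f k)"
  proof (rule dependent_wf_choice[where P = P, OF wf_less_than])
    fix f g :: "nat \<Rightarrow> nat" and k n assume eq: "\<And>z. (z, k) \<in> less_than \<Longrightarrow> f z = g z"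
    then have "f ` {i<..<k} = g ` {i<..<k}" for i by (intro image_cong) auto
    then show "P f k n = P g k n" using eq by (auto simp: P_def)
  next
    fix k :: nat and f assume "\<And>j. (j, k) \<in> less_than \<Longrightarrow> P f j (f j)"
    then have f: "\<And>j. j < k \<Longrightarrow> P f j (f j)" by simp
    have "eventually (\<lambda>n. \<not> accepts (F k n) {}) U" using rej[of k] ultra by (auto simp: F_def)
    moreover have "eventually (\<lambda>n. \<forall>i\<in>{..<k}. \<forall>s\<in>Pow (f ` {i<..<k}). \<not> accepts (F i (f i)) (insert n s)) U"
      using rejects[OF f] by (intro eventually_ball_finite ballI not_accepts) auto
    moreover have "eventually (\<lambda>n. \<forall>i\<in>f ` {..<k}. i < n) U" by (rule eventually_above) simp
    ultimately have "eventually (P f k) U" by eventually_elim (auto simp: P_def)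
    then show "\<exists>n. P f k n" by (rule eventually_ex)
  qed
  then obtain f where f: "\<And>k. P f k (f k)" by blast
  have mono: "strict_mono f" using f by (auto simp: strict_mono_def P_def)
  have rejects': "A \<notin> F i (f i)" if A: "A \<subseteq> f ` {i<..}" "finite A" for A i
  proof -
    obtain D where D: "D \<subseteq> {i<..}" "finite D" "A = f ` D"
      using finite_subset_image[OF A(2,1)] by blast
    then obtain k where k: "D \<subseteq> {..<k}" using finite_nat_iff_bounded by blast
    have "D \<subseteq> {i<..<max k (Suc i)}"
      using D(1) k by (auto simp: subset_iff less_max_iff_disj)
    then have "A \<subseteq> f ` {i<..<max k (Suc i)}" unfolding D(3) by (rule image_mono)
    then have "\<not> accepts (F i (f i)) A" using rejects[of "max k (Suc i)" f i A] f by auto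
    then show ?thesis using accepts.mem by blast
  qed
  have "norm (alternating_sum x A) \<le> c i" if "finite A" "A \<subseteq> f ` {i..}" for A i
    using that
  proof (induction arbitrary: i rule: finite_linorder_min_induct)
    case empty
    then show ?case using c(2) by simp
  next
    case (insert b A)
    then obtain j where j: "b = f j" "i \<le> j" by auto
    have A: "A \<subseteq> f ` {j<..}"
    proof
      fix a assume "a \<in> A"
      then obtain l where "a = f l" "b < a" using insert by auto
      then show "a \<in> f ` {j<..}" using j mono by (auto simp: strict_mono_less)
    qed
    then have "norm (alternating_sum x A) \<le> c (Suc j)"
      by (intro insert.IH) (simp add: Suc_le_eq greaterThan_def atLeast_def)
    with rejects'[OF A insert.hyps(1)] have "norm (x b - alternating_sum x A) \<le> c j"
      using insert.hyps(1) j by (auto simp: F_def far_sets_def)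
    also have "\<dots> \<le> c i" using c(1) j by (simp add: decseqD)
    finally show ?case using insert.hyps by (simp add: alternating_sum_insert_less)
  qed
  then have "norm (alternating_sum (x \<circ> f) A) \<le> c 0" if "finite A" for A
    using that by (simp add: alternating_sum_image[OF mono, symmetric] image_mono)
  with mono show ?thesis by blast
qed

end

section \<open>Bounded alternating sums\<close>

text \<open>The bound lets \<open>extendable\<close> append a term with the wrong sign at little
  cost. For two such vectors the sum has leading coefficient 2 at \<open>q 0\<close>, and the
  difference has coefficient -2 at the shorter one's last term.\<close>

lemma alternating_sums_bounded:
  fixes p :: "nat \<Rightarrow> 'a::real_normed_vector"
  assumes p: "tail_basic p" "\<And>n. norm (p n) = 1"
    and bd: "\<And>A. finite A \<Longrightarrow> norm (alternating_sum p A) \<le> 7/5"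
  shows "symmetrically_separable TYPE('a)"
proof (rule ccontr)
  assume nonsep: "\<not> symmetrically_separable TYPE('a)"
  have V: "alternating_sum p X - p (Min X) \<in> span (p ` {Min X<..Max X})" if X: "finite X" "X \<noteq> {}" for X
  proof -
    have M: "X = insert (Min X) (X - {Min X})" using Min_in[OF X] by blast
    have "Min X < i" if "i \<in> X - {Min X}" for i using that X by (simp add: le_neq_implies_less)
    then have "alternating_sum p X = p (Min X) - alternating_sum p (X - {Min X})"
      using alternating_sum_insert_less[of "X - {Min X}" "Min X" p] X M by simp
    moreover have "span (p ` (X - {Min X})) \<subseteq> span (p ` {Min X<..Max X})"
      using X by (intro span_mono image_mono) (auto simp: le_neq_implies_less)
    ultimately show ?thesis
      using alternating_sum_in_span[of p "X - {Min X}"] span_neg by fastforce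
  qed
  \<comment> \<open>Any bound strictly between 7/5 and 2 leaves room; 19/10 is below the lower bound
    200/101 that the basis constant 101/100 yields.\<close>
  obtain t where t: "\<And>X. finite X \<Longrightarrow> X \<noteq> {} \<Longrightarrow> X \<subseteq> {t..} \<Longrightarrow>
      infinite {m. norm (alternating_sum p X - p m) \<le> 19/10}"
    using extendable[OF p(1) nonsep V, of "7/5" "19/10"] bd by auto
  obtain n0 where n0: "\<And>n a b. n \<ge> n0 \<Longrightarrow> a \<in> span (p ` {..<n}) \<Longrightarrow> b \<in> span (p ` {n..}) \<Longrightarrow>
    norm a \<le> (1 + 1/100) * norm (a + b)"
    using tail_basicE[OF p(1), of "1/100"] by auto
  define P where "P f k m \<longleftrightarrow> max t n0 \<le> m \<and> (\<forall>i<k. f i < m) \<and>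
      (0 < k \<longrightarrow> norm (alternating_sum p (f ` {..<k}) - p m) \<le> 19/10)" for f :: "nat \<Rightarrow> nat" and k m :: nat
  have "\<exists>f. \<forall>k. P f k (f k)"
  proof (rule dependent_wf_choice[where P = P, OF wf_less_than])
    fix f g :: "nat \<Rightarrow> nat" and k m assume eq: "\<And>z. (z, k) \<in> less_than \<Longrightarrow> f z = g z"
    then have "f ` {..<k} = g ` {..<k}" by (intro image_cong) auto
    then show "P f k m = P g k m" using eq by (auto simp: P_def)
  next
    fix k :: nat and f assume "\<And>j. (j, k) \<in> less_than \<Longrightarrow> P f j (f j)"
    then have f: "\<And>j. j < k \<Longrightarrow> max t n0 \<le> f j" by (simp add: P_def)
    show "\<exists>m. P f k m"
    proof (cases "k = 0")
      case True
      then show ?thesis by (auto simp: P_def intro!: exI[of _ "max t n0"])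
    next
      case False
      have "infinite {m. norm (alternating_sum p (f ` {..<k}) - p m) \<le> 19/10}"
        using f False by (intro t) auto
      then obtain m where m: "Max (insert (max t n0) (f ` {..<k})) < m"
          "norm (alternating_sum p (f ` {..<k}) - p m) \<le> 19/10"
        unfolding infinite_nat_iff_unbounded by blast
      then have "P f k m" by (auto simp: P_def)
      then show ?thesis ..
    qed
  qed
  then obtain f where f: "\<And>k. P f k (f k)" by blast
  have mono: "strict_mono f" using f by (auto simp: strict_mono_def P_def)
  define q where "q = p \<circ> f"
  have q: "norm a \<le> 101/100 * norm (a + b)"
    if a: "a \<in> span (q ` {..k})" and b: "b \<in> span (q ` {k<..})" for a b k
  proof -
    have "span (q ` {..k}) \<subseteq> span (p ` {..<Suc (f k)})"
      unfolding q_def image_comp[symmetric] using mono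
      by (intro span_mono image_mono) (auto simp: strict_mono_less_eq less_Suc_eq_le)
    moreover have "span (q ` {k<..}) \<subseteq> span (p ` {Suc (f k)..})"
      unfolding q_def image_comp[symmetric] using mono
      by (intro span_mono image_mono) (auto simp: strict_mono_less Suc_le_eq)
    moreover have "n0 \<le> Suc (f k)" using f[of k] by (simp add: P_def)
    ultimately show ?thesis using n0[of "Suc (f k)" a b] a b by auto
  qed
  have q1: "norm (q n) = 1" for n by (simp add: q_def p(2))
  define s where "s k = (\<Sum>i<k. (-1) ^ i *\<^sub>R q i)" for k :: nat
  have sq: "norm (s k - q k) \<le> 19/10" if "0 < k" for k
    using f[of k] that
    by (simp add: P_def s_def q_def alternating_sum_image[OF mono] alternating_sum_lessThan)
  \<comment> \<open>An even length makes the next correct sign a plus, so subtraction is wrong;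
    \<open>Suc\<close> excludes the empty sum, for which \<open>sq\<close> says nothing.\<close>
  define z where "z k = s (2 * Suc k) - q (2 * Suc k)" for k
  have big: "200/101 \<le> norm v" if "v - a \<in> span (q ` {k<..})" "a = 2 *\<^sub>R q k \<or> a = - (2 *\<^sub>R q k)" for v a k
  proof -
    have "q k \<in> span (q ` {..k})" by (intro span_base) auto
    then have "a \<in> span (q ` {..k})"
      using that(2) by (auto intro: span_neg span_mul)
    then have "norm a \<le> 101/100 * norm (a + (v - a))" using that(1) by (rule q)
    moreover have "norm a = 2" using that(2) q1 by auto
    ultimately show ?thesis by simp
  qed
  have in_span: "(\<Sum>i\<in>I. (-1) ^ i *\<^sub>R q i) \<in> span (q ` {k<..})" if "I \<subseteq> {k<..}" for I k
    using that by (intro span_sum span_mul span_base) auto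
  have plus: "200/101 \<le> norm (z k + z j)" for k j
  proof (rule big)
    have s0: "s (2 * Suc k) - q 0 \<in> span (q ` {0<..})" for k
    proof -
      have "s (2 * Suc k) - q 0 = (\<Sum>i\<in>{1..<2 * Suc k}. (-1) ^ i *\<^sub>R q i)"
        by (simp add: s_def sum.atLeast_Suc_lessThan atLeast0LessThan[symmetric])
      also have "\<dots> \<in> span (q ` {0<..})" by (rule in_span) auto
      finally show ?thesis .
    qed
    have "z k + z j - 2 *\<^sub>R q 0 = (s (2 * Suc k) - q 0) + (s (2 * Suc j) - q 0)
        - (q (2 * Suc k) + q (2 * Suc j))"
      by (simp add: z_def scaleR_2 algebra_simps)
    also have "\<dots> \<in> span (q ` {0<..})"
      by (intro span_diff[OF span_add[OF s0 s0] span_add[OF span_base span_base]]) auto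
    finally show "z k + z j - 2 *\<^sub>R q 0 \<in> span (q ` {0<..})" .
  qed simp
  have minus: "200/101 \<le> norm (z k - z j)" if "k < j" for k j
  proof (rule big)
    let ?I = "{2 * Suc k<..<2 * Suc j}"
    have split: "{..<2 * Suc j} = {..<2 * Suc k} \<union> insert (2 * Suc k) ?I" using that by auto
    have "s (2 * Suc j) = s (2 * Suc k) + (\<Sum>i\<in>insert (2 * Suc k) ?I. (-1) ^ i *\<^sub>R q i)"
      unfolding s_def split by (rule sum.union_disjoint) (simp, simp, force)
    also have "(\<Sum>i\<in>insert (2 * Suc k) ?I. (-1) ^ i *\<^sub>R q i) = q (2 * Suc k) + (\<Sum>i\<in>?I. (-1) ^ i *\<^sub>R q i)"
      by simp
    finally have "z k - z j - (- (2 *\<^sub>R q (2 * Suc k))) = q (2 * Suc j) - (\<Sum>i\<in>?I. (-1) ^ i *\<^sub>R q i)"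
      by (simp add: z_def scaleR_2 algebra_simps)
    also have "\<dots> \<in> span (q ` {2 * Suc k<..})"
      using that by (intro span_diff in_span) (auto intro!: span_base)
    finally show "z k - z j - (- (2 *\<^sub>R q (2 * Suc k))) \<in> span (q ` {2 * Suc k<..})" .
  qed simp
  have "symmetrically_separable TYPE('a)"
  proof (rule symmetrically_separableI[of "1/100" "\<lambda>k. (10/19) *\<^sub>R z k"])
    show "norm ((10/19) *\<^sub>R z n) \<le> 1" for n using sq[of "2 * Suc n"] by (simp add: z_def)
    show "1 + 1/100 \<le> norm ((10/19) *\<^sub>R z n + (10/19) *\<^sub>R z k)" for n k
      using plus[of n k] by (simp add: scaleR_add_right[symmetric] del: scaleR_add_right)
    show "1 + 1/100 \<le> norm ((10/19) *\<^sub>R z n - (10/19) *\<^sub>R z k)" if "n < k" for n k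
      using minus[OF that] by (simp add: scaleR_diff_right[symmetric] del: scaleR_diff_right)
  qed simp
  with nonsep show False ..
qed

section \<open>The dichotomy between acceptance and rejection\<close>

lemma infinite_dimensional_symmetrically_separable:
  assumes "\<not> (\<exists>B :: 'a::real_normed_vector set. finite B \<and> span B = UNIV)"
  shows "symmetrically_separable TYPE('a)"
proof -
  obtain x :: "nat \<Rightarrow> 'a" where x: "tail_basic x" "\<And>n. norm (x n) = 1"
    using tail_basic_exists[OF assms] by blast
  obtain U where "free_ultrafilter U" using free_ultrafilter_exists ..
  then interpret free_ultrafilter U .
  \<comment> \<open>It starts at 7/5, as \<open>alternating_sums_bounded\<close> demands, and
    decreases strictly while staying above 1, so consecutive terms fit
    \<open>accepting_imp_separable\<close>.\<close>
  define c where "c k = 1 + 2 / (5 * Suc k)" for k :: nat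
  have c: "c (Suc k) < c k" "1 \<le> c k" for k by (auto simp: c_def field_simps)
  show ?thesis
  proof (cases "\<exists>k. eventually (\<lambda>n. accepts (far_sets x (c (Suc k)) (x n) (c k)) {}) U")
    case True
    then show ?thesis using accepting_imp_separable[OF x c(2,1)] by blast
  next
    case False
    moreover have "decseq c" using c(1) by (simp add: decseq_Suc_iff less_imp_le)
    moreover have "0 \<le> c k" for k using c(2)[of k] by linarith
    ultimately obtain f where f: "strict_mono f"
        "\<And>A. finite A \<Longrightarrow> norm (alternating_sum (x \<circ> f) A) \<le> c 0"
      using rejecting_subsequence[of c x] x(2) c(2) by auto
    have "c 0 = 7/5" by (simp add: c_def)
    with f show ?thesis
      using alternating_sums_bounded[OF tail_basic_subseq[OF x(1) f(1)]] x(2) by auto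
  qed
qed

theorem theoremA:
  assumes "\<not> (\<exists>B :: 'a::banach set. finite B \<and> span B = UNIV)"
  shows "\<exists>\<epsilon>>0. \<exists>x :: nat \<Rightarrow> 'a. range x \<subseteq> cball 0 1 \<and> symmetrically_separated (1 + \<epsilon>) x"
  using infinite_dimensional_symmetrically_separable[OF assms]
  unfolding symmetrically_separable_def .

end
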